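(* Let $k\ge 7$ be an odd number and let $g=2d\ge 8$. Suppose $G$ is a $(k,g)$-graph of excess $4$, let $c$ be the number of cycles of its excess graph $G(E)$, and let $c_2$ be the number of cycles of $G(E)$ of even length. Then: 1) if $d$ is odd, then $d-1$ divides $c-2$ and $d-1$ divides $c_2$; 2) if $d$ is even, then $d-1$ divides $c-1$ and $d-1$ divides $c_2-1$.
   Context: Graphs are finite and simple. A $(k,g)$-graph is a $k$-regular graph of girth $g$. For even $g=2d$ the Moore bound is $M(k,g)=2\bigl(1+(k-1)+\dots+(k-1)^{d-1}\bigr)$, and the excess of a $(k,g)$-graph of order $n$ is $n-M(k,g)$. For $k\ge 6$ and $g=2d\ge 6$, a $(k,g)$-graph $G$ of excess $4$ is bipartite of diameter $d+1$ (known theorem of Biggs and Ito). The excess graph $G(E)$ of $G$ is the graph on the vertex set of $G$ in which two vertices are adjacent if and only if their distance in $G$ is $d+1$. It is a disjoint union of cycles (the connected components of $G(E)$), and the number of cycles of $G(E)$ means the number of these components. *)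

theory Defs
  imports "Graph_Theory.Graph_Theory"
begin

text \<open>
  A finite simple graph is a finite, symmetric, loop-free digraph without parallel arcs
  (locale \<^locale>\<open>pair_graph\<close>): an undirected edge is a pair of opposite arcs, so the degree
  of a vertex is its out-degree.
\<close>

definition regular :: "nat \<Rightarrow> 'a pair_pre_digraph \<Rightarrow> bool" where
  "regular k G \<longleftrightarrow> (\<forall>v \<in> pverts G. out_degree (with_proj G) v = k)"

text \<open>
  In a symmetric digraph the closed walk \<open>u, v, u\<close> along one edge is a \<open>cycle\<close>;
  requiring length at least 3 leaves exactly the cycles of the undirected graph.
  The girth of an acyclic graph is \<open>\<infinity>\<close>.
\<close>

definition girth :: "'a pair_pre_digraph \<Rightarrow> enat" where
  "girth G = (INF p \<in> {p. pre_digraph.cycle (with_proj G) p \<and> 3 \<le> length p}. enat (length p))"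

definition kg_graph :: "nat \<Rightarrow> nat \<Rightarrow> 'a pair_pre_digraph \<Rightarrow> bool" where
  "kg_graph k g G \<longleftrightarrow> pair_graph G \<and> regular k G \<and> girth G = enat g"

text \<open>The bound below is the Moore bound for even \<open>g\<close> only.\<close>

definition moore_bound_even :: "nat \<Rightarrow> nat \<Rightarrow> nat" where
  "moore_bound_even k g = 2 * (\<Sum>i < g div 2. (k - 1) ^ i)"

definition excess :: "nat \<Rightarrow> nat \<Rightarrow> 'a pair_pre_digraph \<Rightarrow> int" where
  "excess k g G = int (card (pverts G)) - int (moore_bound_even k g)"

text \<open>Distance is the shortest-path distance for unit arc weights (\<open>\<infinity>\<close> if unreachable).\<close>

definition graph_dist :: "'a pair_pre_digraph \<Rightarrow> 'a \<Rightarrow> 'a \<Rightarrow> ereal" where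
  "graph_dist G u v = wf_digraph.\<mu> (with_proj G) (\<lambda>_. 1) u v"

definition excess_graph :: "nat \<Rightarrow> 'a pair_pre_digraph \<Rightarrow> 'a pair_pre_digraph" where
  "excess_graph d G =
     \<lparr> pverts = pverts G,
       parcs = {(u, v). u \<in> pverts G \<and> v \<in> pverts G \<and> graph_dist G u v = ereal (real (d + 1))} \<rparr>"

text \<open>
  The connected components of a symmetric digraph are its strongly connected components.
  When they are cycles, the length of one is its number of vertices.
\<close>

definition components :: "'a pair_pre_digraph \<Rightarrow> ('a, 'a \<times> 'a) pre_digraph set" where
  "components H = pre_digraph.sccs (with_proj H)"

definition num_cycles :: "'a pair_pre_digraph \<Rightarrow> nat" where
  "num_cycles H = card (components H)"

definition num_even_cycles :: "'a pair_pre_digraph \<Rightarrow> nat" where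
  "num_even_cycles H = card {C \<in> components H. even (card (verts C))}"

end

theory Submission
  imports Defs "HOL-Computational_Algebra.Polynomial_Factorial" "HOL-Library.Function_Algebras"
begin

text \<open>
  Let \<open>q = k - 1\<close>, and fix a vertex \<open>z\<close>. A graph of girth \<open>2d\<close> is a tree up to distance \<open>d - 1\<close> from \<open>z\<close>.
  Every edge at \<open>z\<close> leaves exactly four vertices at distance at least \<open>d\<close> from both of its ends;
  counting the edges between the vertices at distance at least \<open>d\<close> from \<open>z\<close> forces exactly two vertices
  at distance \<open>d + 1\<close>, none further away, and no edge between equidistant vertices. So the graph is
  bipartite of diameter \<open>d + 1\<close> and the adjacency operator \<open>E\<close> of the excess graph satisfies
  \<open>p(A) + E = J'\<close>, where \<open>p\<close> is the polynomial of degree \<open>d - 1\<close> given by \<open>p\<^sub>0 = 1\<close>, \<open>p\<^sub>1 = x\<close>,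
  \<open>p\<^bsub>n+2\<^esub> = x p\<^bsub>n+1\<^esub> - q p\<^sub>n\<close>, and \<open>J'\<close> vanishes on functions summing to zero on both halves. On such
  functions the eigenspace of \<open>E\<close> for \<open>2\<close> or \<open>-2\<close> is a rational \<open>A\<close>-invariant space annihilated by
  \<open>p + 2\<close> or \<open>p - 2\<close>. As \<open>q\<close> is even, these polynomials are irreducible by Eisenstein's criterion
  at \<open>2\<close>, so \<open>d - 1\<close> divides the dimensions of the two spaces. Without the sum conditions the
  dimensions are \<open>c\<close> and \<open>c\<^sub>2\<close>; depending on the parity of \<open>d\<close>, the conditions cost \<open>2\<close> and \<open>0\<close>,
  or \<open>1\<close> and \<open>1\<close>.
\<close>

section \<open>Endomorphisms annihilated by an irreducible polynomial\<close>

locale vector_space_endo = vector_space scale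
  for scale :: "'k::field \<Rightarrow> 'b::ab_group_add \<Rightarrow> 'b" (infixr \<open>*s\<close> 75) +
  fixes T :: "'b \<Rightarrow> 'b"
  assumes T_add: "T (x + y) = T x + T y"
    and T_scale: "T (c *s x) = c *s T x"
begin

lemma T_zero [simp]: "T 0 = 0"
  using T_scale[of 0 0] by simp

text \<open>The action of K[x] in which x acts as \<open>T\<close>.\<close>

definition poly_op :: "'k poly \<Rightarrow> 'b \<Rightarrow> 'b" where
  "poly_op p v = (\<Sum>i\<le>degree p. coeff p i *s (T ^^ i) v)"

lemma T_sum: "T (\<Sum>i\<in>I. f i) = (\<Sum>i\<in>I. T (f i))"
  by (induction I rule: infinite_finite_induct) (auto simp: T_add)

lemma poly_op_0 [simp]: "poly_op 0 v = 0"
  by (simp add: poly_op_def)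

lemma poly_op_pCons: "poly_op (pCons a p) v = a *s v + T (poly_op p v)"
proof (cases "p = 0")
  case False
  then show ?thesis
    by (simp add: poly_op_def sum.atMost_Suc_shift T_sum T_scale del: sum.atMost_Suc)
qed (simp add: poly_op_def)

lemma poly_op_add: "poly_op (p + q) v = poly_op p v + poly_op q v"
  by (induction p q rule: poly_induct2) (auto simp: poly_op_pCons T_add scale_left_distrib)

lemma poly_op_smult: "poly_op (smult a p) v = a *s poly_op p v"
  by (induction p) (auto simp: poly_op_pCons T_scale scale_right_distrib)

lemma poly_op_mult: "poly_op (p * q) v = poly_op p (poly_op q v)"
  by (induction p) (auto simp: poly_op_pCons poly_op_add poly_op_smult)

lemma poly_op_diff: "poly_op (p - q) v = poly_op p v - poly_op q v"
  using poly_op_add[of "p - q" q v] by (simp add: algebra_simps)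

lemma poly_op_zero_right [simp]: "poly_op p 0 = 0"
  by (induction p) (auto simp: poly_op_pCons)

lemma poly_op_monom: "poly_op (monom 1 n) v = (T ^^ n) v"
  by (induction n) (auto simp: poly_op_pCons monom_Suc monom_0)

lemma poly_op_mem:
  assumes "subspace U" "\<And>u. u \<in> U \<Longrightarrow> T u \<in> U" "v \<in> U"
  shows "poly_op p v \<in> U"
  using assms
  by (induction p) (auto simp: poly_op_pCons subspace_0 subspace_add subspace_scale)

lemma T_poly_op: "T (poly_op p v) = poly_op (pCons 0 p) v"
  by (simp add: poly_op_pCons)

text \<open>For \<open>v \<notin> U\<close> the annihilator of \<open>v\<close> modulo \<open>U\<close> is the ideal generated by the irreducible \<open>p\<close>.\<close>

lemma irreducible_annihilator_degree:
  assumes p: "irreducible p" and U: "subspace U" "\<And>u. u \<in> U \<Longrightarrow> T u \<in> U"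
    and v: "v \<notin> U" "poly_op p v = 0" and r: "r \<noteq> 0" "poly_op r v \<in> U"
  shows "degree p \<le> degree r"
  using r
proof (induction "degree r" arbitrary: r rule: less_induct)
  case less
  \<comment> \<open>Euclid's algorithm: since \<open>p\<close> kills \<open>v\<close>, the remainder
    again sends \<open>v\<close> into \<open>U\<close>. Either it is nonzero and of smaller degree
    than \<open>r\<close>, or \<open>r\<close> divides the irreducible \<open>p\<close>.\<close>
  have "poly_op (p mod r) v = poly_op p v - poly_op (p div r) (poly_op r v)"
    by (simp add: minus_div_mult_eq_mod [symmetric] poly_op_diff poly_op_mult)
  moreover have "poly_op (p div r) (poly_op r v) \<in> U"
    by (rule poly_op_mem[OF U less.prems(2)])
  ultimately have mod: "poly_op (p mod r) v \<in> U"
    using v(2) U(1) by (simp add: subspace_neg)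
  show ?case
  proof (cases "p mod r = 0")
    case False
    then have "degree (p mod r) < degree r"
      using degree_mod_less less.prems by blast
    then show ?thesis using less.hyps[OF _ False mod] by auto
  next
    case True
    then obtain s where s: "p = r * s" by (auto simp: mod_eq_0_iff_dvd)
    have "p \<noteq> 0" using p by auto
    \<comment> \<open>A unit \<open>r\<close> would be a nonzero constant and put \<open>v\<close>
      itself into \<open>U\<close>. Hence the cofactor \<open>s\<close> is the unit.\<close>
    have "\<not> r dvd 1"
    proof
      assume "r dvd 1"
      then obtain c where c: "r = [:c:]" "c \<noteq> 0"
        by (metis is_unit_polyE dvd_0_left zero_neq_one)
      then have "c *s v \<in> U" using less.prems by (simp add: poly_op_pCons)
      then have "inverse c *s (c *s v) \<in> U" using U subspace_scale by blast
      then show False using v c by simp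
    qed
    then have "s dvd 1" using irreducibleD[OF p s] by blast
    then have "degree s = 0" by (metis degree_1 dvd_imp_degree_le le_zero_eq one_neq_zero)
    then show ?thesis using s \<open>p \<noteq> 0\<close> by (auto simp: degree_mult_eq)
  qed
qed

text \<open>A linear relation between the iterates of \<open>v\<close> modulo \<open>span B\<close>
  would be a nonzero polynomial of degree less than \<open>degree p\<close> sending \<open>v\<close>
  into \<open>span B\<close>. The inclusion for the span is carried through the induction because it
  exposes this polynomial.\<close>

lemma independent_insert_orbit:
  assumes p: "irreducible p" and B: "independent B" "\<And>u. u \<in> span B \<Longrightarrow> T u \<in> span B"
    and v: "v \<notin> span B" "poly_op p v = 0" and j: "j \<le> degree p" and fin: "finite B"
  defines "C \<equiv> (\<lambda>i. (T ^^ i) v) ` {..<j}"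
  shows "independent (B \<union> C) \<and> card (B \<union> C) = card B + j
    \<and> span (B \<union> C) \<subseteq> {u + poly_op r v | u r. u \<in> span B \<and> (r = 0 \<or> degree r < j)}"
  using j unfolding C_def
proof (induction j)
  case 0
  then show ?case using B by (auto intro!: exI[of _ "0 :: 'k poly"])
next
  case (Suc j)
  define D where "D = B \<union> (\<lambda>i. (T ^^ i) v) ` {..<j}"
  have IH: "independent D" "card D = card B + j"
    "span D \<subseteq> {u + poly_op r v | u r. u \<in> span B \<and> (r = 0 \<or> degree r < j)}"
    using Suc by (auto simp: D_def)
  have eq: "B \<union> (\<lambda>i. (T ^^ i) v) ` {..<Suc j} = insert ((T ^^ j) v) D"
    by (auto simp: D_def lessThan_Suc)
  have notin: "(T ^^ j) v \<notin> span D"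
  proof
    assume "(T ^^ j) v \<in> span D"
    then obtain u r where ur: "(T ^^ j) v = u + poly_op r v" "u \<in> span B" "r = 0 \<or> degree r < j"
      using IH by blast
    \<comment> \<open>The offending polynomial is monic of degree \<open>j\<close>, and here
      \<open>j < degree p\<close>.\<close>
    have "poly_op (monom 1 j - r) v = u"
      using ur by (simp add: poly_op_diff poly_op_monom)
    moreover have co: "coeff (monom 1 j - r) j = 1"
      using ur(3) by (auto simp: coeff_eq_0)
    moreover have "monom 1 j - r \<noteq> 0" using co by (metis coeff_0 zero_neq_one)
    moreover have "degree (monom 1 j - r) \<le> j"
      using ur(3) by (intro degree_diff_le) (auto simp: degree_monom_eq)
    ultimately show False
      using irreducible_annihilator_degree[OF p subspace_span B(2) v, of "monom 1 j - r"] Suc.prems ur(2)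
      by simp
  qed
  have "finite D" using fin by (auto simp: D_def)
  have "span (insert ((T ^^ j) v) D) \<subseteq>
     {u + poly_op r v | u r. u \<in> span B \<and> (r = 0 \<or> degree r < Suc j)}"
  proof
    fix x assume "x \<in> span (insert ((T ^^ j) v) D)"
    then obtain a where "x - a *s (T ^^ j) v \<in> span D" by (auto simp: span_insert)
    then obtain u r where ur: "x - a *s (T ^^ j) v = u + poly_op r v" "u \<in> span B" "r = 0 \<or> degree r < j"
      using IH by blast
    have "x = u + poly_op (r + smult a (monom 1 j)) v"
      using ur(1) by (simp add: poly_op_add poly_op_smult poly_op_monom algebra_simps)
    moreover have "degree (r + smult a (monom 1 j)) \<le> j"
      using ur(3) by (intro degree_add_le) (auto simp: degree_monom_eq intro: order_trans[OF degree_smult_le])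
    ultimately show "x \<in> {u + poly_op r v | u r. u \<in> span B \<and> (r = 0 \<or> degree r < Suc j)}"
      using ur(2) less_Suc_eq_le by blast
  qed
  moreover have "(T ^^ j) v \<notin> D" using notin span_base by blast
  ultimately show ?case
    unfolding eq using IH notin \<open>finite D\<close> by (simp add: independent_insert)
qed

text \<open>Take a largest independent subset of \<open>W\<close> whose span is invariant and whose
  size is a multiple of \<open>degree p\<close>. If its span missed a vector of \<open>W\<close>,
  the first \<open>degree p\<close> iterates of that vector would enlarge it.\<close>

lemma irreducible_annihilator_degree_dvd_dim:
  assumes p: "irreducible p" and W: "subspace W" "\<And>w. w \<in> W \<Longrightarrow> T w \<in> W"
    and ann: "\<And>w. w \<in> W \<Longrightarrow> poly_op p w = 0" and fin: "finite S" "W \<subseteq> span S"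
  shows "degree p dvd dim W"
proof -
  define P where "P n \<longleftrightarrow> (\<exists>B. B \<subseteq> W \<and> finite B \<and> independent B \<and> card B = n \<and> degree p dvd n
    \<and> (\<forall>u \<in> span B. T u \<in> span B))" for n
  have "P 0" unfolding P_def by (rule exI[of _ "{}"]) (auto simp: independent_empty)
  moreover have bound: "n \<le> card S" if "P n" for n
    using that independent_span_bound[OF fin(1)] fin(2) unfolding P_def by blast
  ultimately obtain N where N: "P N" and max: "\<And>n. P n \<Longrightarrow> n \<le> N"
    by (metis GreatestI_nat Greatest_le_nat)
  obtain B where B: "B \<subseteq> W" "finite B" "independent B" "card B = N"
    "degree p dvd card B" "\<And>u. u \<in> span B \<Longrightarrow> T u \<in> span B"
    using N unfolding P_def by auto
  have "p \<noteq> 0" using p by auto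
  have dp: "degree p > 0"
    using p \<open>p \<noteq> 0\<close> by (metis gr0I irreducible_not_unit is_unit_iff_degree)
  have "W \<subseteq> span B"
  proof (rule ccontr)
    assume "\<not> W \<subseteq> span B"
    then obtain v where v: "v \<in> W" "v \<notin> span B" by blast
    define C where "C = B \<union> (\<lambda>i. (T ^^ i) v) ` {..<degree p}"
    have *: "independent C" "card C = card B + degree p"
      "span C \<subseteq> {u + poly_op r v | u r. u \<in> span B \<and> (r = 0 \<or> degree r < degree p)}"
      unfolding C_def
      using independent_insert_orbit[OF p B(3) _ v(2) ann[OF v(1)] order_refl B(2)] B(6) by auto
    have pw: "(T ^^ i) v \<in> W" for i using v W by (induction i) auto
    have CW: "C \<subseteq> W" using B pw by (auto simp: C_def)
    have poly_in: "poly_op r v \<in> span C" for r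
    proof -
      \<comment> \<open>\<open>p\<close> kills \<open>v\<close>, so only remainders modulo
        \<open>p\<close> matter, and these involve no iterate beyond those in \<open>C\<close>. This
        makes the enlarged span invariant.\<close>
      have "poly_op r v = poly_op (r mod p) v"
        by (metis (no_types) add_0 ann[OF v(1)] div_mult_mod_eq poly_op_add poly_op_mult poly_op_zero_right)
      also have "\<dots> \<in> span C"
      proof (cases "r mod p = 0")
        case False
        then have "degree (r mod p) < degree p" using degree_mod_less \<open>p \<noteq> 0\<close> by blast
        then show ?thesis unfolding poly_op_def
          by (intro span_sum span_scale span_base) (auto simp: C_def)
      qed (auto simp: span_zero)
      finally show ?thesis .
    qed
    have inv: "T u \<in> span C" if u: "u \<in> span C" for u
    proof -
      obtain u' r where u': "u = u' + poly_op r v" "u' \<in> span B" using u *(3) by blast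
      have "T u' \<in> span C" using u'(2) B(6) span_mono[of B C] by (auto simp: C_def)
      then show ?thesis unfolding u'(1) T_add T_poly_op using poly_in by (rule span_add)
    qed
    have "P (card C)" unfolding P_def
      using CW *(1,2) B(2,5) inv by (intro exI[of _ C]) (auto simp: C_def)
    with max have "card C \<le> card B" by (simp add: B(4))
    then show False using *(2) dp by simp
  qed
  then have "dim W = card B" using B dim_unique by blast
  then show ?thesis using B(5) by simp
qed

end

context vector_space
begin

text \<open>Subtracting a multiple of \<open>b\<close> moves any vector of \<open>U\<close> into the
  kernel, so a basis of the kernel together with \<open>b\<close> is a basis of
  \<open>U\<close>.\<close>

lemma dim_kernel_functional:
  fixes \<phi> :: "'b \<Rightarrow> 'a"
  assumes U: "subspace U" and \<phi>: "\<And>x y. \<phi> (x + y) = \<phi> x + \<phi> y" "\<And>c x. \<phi> (scale c x) = c * \<phi> x"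
    and b: "b \<in> U" "\<phi> b \<noteq> 0" and fin: "finite S" "U \<subseteq> span S"
  shows "dim U = Suc (dim {x \<in> U. \<phi> x = 0})"
proof -
  define K where "K = {x \<in> U. \<phi> x = 0}"
  have \<phi>0: "\<phi> 0 = 0" using \<phi>(2)[of 0 0] by simp
  have K: "subspace K"
    unfolding K_def using U by (auto simp: subspace_def \<phi> \<phi>0)
  obtain B where B: "B \<subseteq> K" "independent B" "K \<subseteq> span B" "card B = dim K"
    using basis_exists by blast
  have "finite B"
    using independent_span_bound[OF fin(1) B(2)] B(1) fin(2) by (auto simp: K_def)
  have spB: "span B \<subseteq> K" using B K span_minimal by blast
  then have nb: "b \<notin> span B" using b by (auto simp: K_def)
  have "U \<subseteq> span (insert b B)"
  proof
    fix x assume x: "x \<in> U"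
    have "x - scale (\<phi> x / \<phi> b) b \<in> K"
      using x b U \<phi>(1)[of "x - scale (\<phi> x / \<phi> b) b" "scale (\<phi> x / \<phi> b) b"]
      by (auto simp: K_def \<phi>(2) intro: subspace_diff subspace_scale)
    then show "x \<in> span (insert b B)" using B by (auto simp: span_insert)
  qed
  moreover have "insert b B \<subseteq> U" using b B by (auto simp: K_def)
  moreover have "independent (insert b B)" using nb B by (simp add: independent_insert)
  moreover have "card (insert b B) = Suc (card B)"
    using nb \<open>finite B\<close> span_base by (intro card_insert_disjoint) auto
  ultimately show ?thesis using B dim_unique by (metis K_def)
qed

end

section \<open>An Eisenstein family of polynomials\<close>

text \<open>The Dickson polynomials of the second kind with parameter \<open>q\<close>.\<close>

fun geo :: "'c::comm_ring_1 \<Rightarrow> nat \<Rightarrow> 'c poly" where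
  "geo q 0 = 1"
| "geo q (Suc 0) = [:0, 1:]"
| "geo q (Suc (Suc n)) = pCons 0 (geo q (Suc n)) - smult q (geo q n)"

lemma degree_geo: "degree (geo q n) \<le> n"
  by (induction q n rule: geo.induct)
     (auto intro!: degree_diff_le order_trans[OF degree_smult_le] order_trans[OF degree_pCons_le])

lemma coeff_geo_top: "coeff (geo q n) n = 1"
proof (induction q n rule: geo.induct)
  case (3 q n)
  have "coeff (geo q n) (Suc (Suc n)) = 0"
    by (rule coeff_eq_0) (use degree_geo[of q n] in simp)
  with 3 show ?case by simp
qed auto

lemma map_poly_to_fract_geo: "fract_poly (geo q n) = geo (to_fract q) n"
  by (induction q n rule: geo.induct) (simp_all add: map_poly_pCons)

lemma dvd_coeff_geo: "p dvd q \<Longrightarrow> i < n \<Longrightarrow> p dvd coeff (geo q n) i"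
proof (induction q n arbitrary: i rule: geo.induct)
  case (3 q n)
  show ?case
    using 3 by (cases i) (auto intro!: dvd_diff dvd_mult2)
qed auto

text \<open>The constant term of \<open>geo q n\<close> is \<open>- q\<close> times that of
  \<open>geo q (n - 2)\<close>; as \<open>n - 2\<close> is positive, \<open>p\<close> divides both
  factors.\<close>

lemma dvd_coeff_geo_0: "p dvd q \<Longrightarrow> 3 \<le> n \<Longrightarrow> p\<^sup>2 dvd coeff (geo q n) 0"
proof (cases n)
  case (Suc m)
  assume *: "p dvd q" "3 \<le> n"
  then obtain l where l: "n = Suc (Suc l)" "0 < l" using Suc by (cases m) auto
  then show ?thesis using *(1) dvd_coeff_geo[OF *(1), of 0 l]
    by (auto simp: power2_eq_square intro!: mult_dvd_mono)
qed auto

text \<open>Let \<open>i\<close> be the lowest index at which \<open>p\<close> does not divide the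
  coefficient of \<open>a\<close>. Modulo \<open>p\<close> the coefficient of \<open>a * b\<close>
  at \<open>i\<close> is \<open>coeff a i * coeff b 0\<close>, which is nonzero although
  \<open>i\<close> is below the degree of the product.\<close>

lemma eisenstein_aux:
  fixes a b :: "int poly"
  assumes p: "prime p" and dvd: "\<And>i. i < degree (a * b) \<Longrightarrow> p dvd coeff (a * b) i"
    and lead: "\<not> p dvd lead_coeff a" and deg: "degree a < degree (a * b)"
    and b0: "\<not> p dvd coeff b 0"
  shows False
proof -
  define i where "i = (LEAST i. \<not> p dvd coeff a i)"
  have i: "\<not> p dvd coeff a i" "i \<le> degree a" "\<And>j. j < i \<Longrightarrow> p dvd coeff a j"
    unfolding i_def using LeastI[of "\<lambda>i. \<not> p dvd coeff a i", OF lead] lead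
    by (auto intro: Least_le dest: not_less_Least)
  have "coeff (a * b) i = coeff a i * coeff b 0 + (\<Sum>j<i. coeff a j * coeff b (i - j))"
    by (simp add: coeff_mult lessThan_Suc_atMost[symmetric])
  moreover have "p dvd (\<Sum>j<i. coeff a j * coeff b (i - j))"
    using i(3) by (intro dvd_sum) auto
  ultimately have "p dvd coeff a i * coeff b 0"
    using dvd[of i] i(2) deg by (simp add: dvd_add_left_iff)
  then show False using p i(1) b0 by (simp add: prime_dvd_mult_iff)
qed

lemma eisenstein:
  fixes f :: "int poly"
  assumes p: "prime p" and monic: "lead_coeff f = 1" and deg: "0 < degree f"
    and dvd: "\<And>i. i < degree f \<Longrightarrow> p dvd coeff f i" and f0: "\<not> p\<^sup>2 dvd coeff f 0"
  shows "irreducible f"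
proof (rule irreducibleI)
  show "f \<noteq> 0" using deg by auto
  show "\<not> f dvd 1" using deg by (auto simp: is_unit_poly_iff)
next
  fix a b assume ab: "f = a * b"
  then have l: "lead_coeff a * lead_coeff b = 1" using monic by (simp add: lead_coeff_mult)
  \<comment> \<open>Both leading coefficients are units, so \<open>p\<close> divides neither, and a
    factor of degree 0 is a unit.\<close>
  then have u: "is_unit (lead_coeff a)" "is_unit (lead_coeff b)"
    by (metis dvd_triv_left, metis dvd_triv_right)
  then have np: "\<not> p dvd lead_coeff a" "\<not> p dvd lead_coeff b"
    using p dvd_trans not_prime_unit by blast+
  have nz: "a \<noteq> 0" "b \<noteq> 0" using ab deg by auto
  have deg_sum: "degree (a * b) = degree a + degree b" using nz by (rule degree_mult_eq)
  show "a dvd 1 \<or> b dvd 1"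
  proof (cases "degree a = 0 \<or> degree b = 0")
    case True
    then show ?thesis using u by (auto elim!: degree_eq_zeroE simp: is_unit_poly_iff)
  next
    case False
    then have less: "degree a < degree (a * b)" "degree b < degree (b * a)"
      using deg_sum by (auto simp: mult.commute)
    \<comment> \<open>The factor whose constant term is not divisible by \<open>p\<close> takes the
      role of \<open>b\<close> in \<open>eisenstein_aux\<close>.\<close>
    have "\<not> (p dvd coeff a 0 \<and> p dvd coeff b 0)"
      using f0 by (auto simp: ab coeff_mult power2_eq_square mult_dvd_mono)
    then show ?thesis
      using eisenstein_aux[OF p _ np(1) less(1)] eisenstein_aux[OF p _ np(2) less(2)] dvd
      by (auto simp: ab mult.commute)
  qed
qed

text \<open>For \<open>n \<ge> 3\<close> the constant term of \<open>geo q n\<close> is divisible by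
  4, so adding \<open>s\<close> makes it 2 modulo 4. Eisenstein at 2 applies over the integers, and
  Gauss's lemma carries irreducibility to the fraction field.\<close>

lemma irreducible_geo:
  fixes q :: int
  assumes "even q" "3 \<le> n" "even s" "\<not> 4 dvd s"
  shows "irreducible (geo (to_fract q) n + [:to_fract s:])"
proof -
  define f where "f = geo q n + [:s:]"
  have co: "coeff f i = coeff (geo q n) i + (if i = 0 then s else 0)" for i
    by (simp add: f_def coeff_pCons split: nat.split)
  have "degree f \<le> n" unfolding f_def using degree_geo by (intro degree_add_le) auto
  moreover have "coeff f n = 1" using co assms(2) by (simp add: coeff_geo_top)
  ultimately have f: "degree f = n" "lead_coeff f = 1"
    by (metis le_antisym le_degree zero_neq_one)+
  have "\<not> 4 dvd coeff f 0"
    using dvd_coeff_geo_0[of 2 q n] assms by (simp add: co dvd_add_right_iff)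
  then have "irreducible f"
    using f assms by (intro eisenstein[of 2]) (auto simp: co dvd_coeff_geo intro!: dvd_add)
  then have "irreducible (fract_poly f)"
    using nonconst_poly_irreducible_iff[of f] f assms by auto
  moreover have "fract_poly f = geo (to_fract q) n + [:to_fract s:]"
    by (simp add: f_def map_poly_to_fract_geo map_poly_pCons)
  ultimately show ?thesis by simp
qed


section \<open>Graphs of even girth and excess four\<close>

text \<open>Girth enters only through \<open>unique_pred\<close> and \<open>no_level_edge\<close>:
  seen from any vertex the graph is a tree below distance \<open>d\<close>. \<open>D_pred\<close>
  stops at \<open>d + 1\<close> because unreachable vertices will get a default distance above it;
  connectedness is derived in \<open>D_le\<close>.\<close>

locale moore_distance =
  fixes V :: "'a set" and N :: "'a \<Rightarrow> 'a set" and D :: "'a \<Rightarrow> 'a \<Rightarrow> nat" and k d :: nat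
  assumes finite_V: "finite V"
    and N_subset: "v \<in> V \<Longrightarrow> N v \<subseteq> V"
    and N_sym: "u \<in> V \<Longrightarrow> v \<in> N u \<Longrightarrow> u \<in> N v"
    and card_N: "v \<in> V \<Longrightarrow> card (N v) = k"
    and D_eq_0: "u \<in> V \<Longrightarrow> v \<in> V \<Longrightarrow> D u v = 0 \<longleftrightarrow> u = v"
    and D_sym: "u \<in> V \<Longrightarrow> v \<in> V \<Longrightarrow> D u v = D v u"
    and D_step: "u \<in> V \<Longrightarrow> v \<in> V \<Longrightarrow> w \<in> N v \<Longrightarrow> D u w \<le> Suc (D u v)"
    and D_pred: "u \<in> V \<Longrightarrow> v \<in> V \<Longrightarrow> 0 < D u v \<Longrightarrow> D u v \<le> Suc d \<Longrightarrow> \<exists>w \<in> N v. D u w < D u v"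
    and unique_pred: "u \<in> V \<Longrightarrow> v \<in> V \<Longrightarrow> D u v < d \<Longrightarrow>
      w \<in> N v \<Longrightarrow> w' \<in> N v \<Longrightarrow> D u w < D u v \<Longrightarrow> D u w' < D u v \<Longrightarrow> w = w'"
    and no_level_edge: "u \<in> V \<Longrightarrow> v \<in> V \<Longrightarrow> w \<in> N v \<Longrightarrow> D u w = D u v \<Longrightarrow> d \<le> D u v"
    and card_V: "card V = 2 * (\<Sum>i<d. (k - 1) ^ i) + 4"
    and k_ge: "7 \<le> k" and d_ge: "3 \<le> d"
begin

lemma N_in_V: "v \<in> V \<Longrightarrow> w \<in> N v \<Longrightarrow> w \<in> V"
  using N_subset by blast

lemma finite_N: "v \<in> V \<Longrightarrow> finite (N v)"
  using finite_V N_subset finite_subset by blast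

lemma D_step': "u \<in> V \<Longrightarrow> v \<in> V \<Longrightarrow> w \<in> N v \<Longrightarrow> D u v \<le> Suc (D u w)"
  using D_step[of u w v] N_sym[of v w] N_in_V by blast

lemma D_step_left: "z \<in> V \<Longrightarrow> y \<in> V \<Longrightarrow> w \<in> N z \<Longrightarrow> D w y \<le> Suc (D z y)"
  using D_step[of y z w] D_sym N_in_V by metis

lemma D_step_left': "z \<in> V \<Longrightarrow> y \<in> V \<Longrightarrow> w \<in> N z \<Longrightarrow> D z y \<le> Suc (D w y)"
  using D_step'[of y z w] D_sym N_in_V by metis

lemma N_irrefl: "v \<in> V \<Longrightarrow> v \<notin> N v"
  using no_level_edge[of v v v] D_eq_0[of v v] d_ge by fastforce

lemma level_edge_left: "z \<in> V \<Longrightarrow> w \<in> N z \<Longrightarrow> y \<in> V \<Longrightarrow> D z y = D w y \<Longrightarrow> d \<le> D z y"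
  using no_level_edge[of y z w] D_sym[of y] N_in_V by metis

section \<open>Level counts around a vertex and around an edge\<close>

lemma card_pred:
  assumes "u \<in> V" "v \<in> V" "0 < D u v" "D u v < d"
  shows "card {w \<in> N v. D u w < D u v} = 1"
proof -
  obtain w where "w \<in> N v" "D u w < D u v" using D_pred assms by fastforce
  then have "{w \<in> N v. D u w < D u v} = {w}" using unique_pred assms by blast
  then show ?thesis by simp
qed

lemma card_succ:
  assumes "u \<in> V" "v \<in> V" "0 < D u v" "D u v < d"
  shows "card {w \<in> N v. D u v < D u w} = k - 1"
proof -
  have "{w \<in> N v. D u v < D u w} = N v - {w \<in> N v. D u w < D u v}"
    using no_level_edge[OF assms(1,2)] assms(4) by fastforce
  then show ?thesis
    using card_pred[OF assms] card_N assms finite_N by (simp add: card_Diff_subset)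
qed

text \<open>This is one level on the side of \<open>z\<close> in the tree grown from the edge
  \<open>zw\<close>. Each of its vertices has \<open>k - 1\<close> successors and each vertex of the
  next level has one predecessor; counting the edges in between gives the factor
  \<open>k - 1\<close>.\<close>

lemma card_edge_level:
  assumes z: "z \<in> V" "w \<in> N z" and "i < d"
  shows "card {y \<in> V. D z y = i \<and> D w y = Suc i} = (k - 1) ^ i"
  using \<open>i < d\<close>
proof (induction i)
  case 0
  have w: "w \<in> V" "w \<noteq> z" using z N_in_V N_irrefl by auto
  have "D w z = 1"
    using D_step_left[OF z(1) z(1) z(2)] D_eq_0[OF w(1) z(1)] D_eq_0[OF z(1) z(1)] w by simp
  then have "{y \<in> V. D z y = 0 \<and> D w y = Suc 0} = {z}" using z D_eq_0 by auto
  then show ?case by simp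
next
  case (Suc i)
  have w: "w \<in> V" using z N_in_V by blast
  define A where "A = {y \<in> V. D z y = i \<and> D w y = Suc i}"
  define B where "B = {y \<in> V. D z y = Suc i \<and> D w y = Suc (Suc i)}"
  have fin: "finite A" "finite B" using finite_V by (auto simp: A_def B_def)
  have "card {b \<in> B. b \<in> N a} = k - 1" if "a \<in> A" for a
  proof -
    have a: "a \<in> V" "D z a = i" "D w a = Suc i" using that by (auto simp: A_def)
    \<comment> \<open>Successors are taken with respect to \<open>w\<close>: this leaves out
      \<open>w\<close> itself at level 0 and keeps the count \<open>k - 1\<close> uniform.\<close>
    have "{b \<in> B. b \<in> N a} = {b \<in> N a. D w a < D w b}"
    proof (intro set_eqI iffI)
      fix b assume "b \<in> {b \<in> N a. D w a < D w b}"
      then have b: "b \<in> N a" "D w a < D w b" by auto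
      then have bV: "b \<in> V" using N_in_V a by blast
      have "D w b = Suc (Suc i)" using D_step[OF w a(1) b(1)] b a by simp
      moreover have "D z b = Suc i"
        using D_step_left[OF z(1) bV z(2)] D_step[OF z(1) a(1) b(1)] a \<open>D w b = Suc (Suc i)\<close> by simp
      ultimately show "b \<in> {b \<in> B. b \<in> N a}" using b bV by (simp add: B_def)
    qed (auto simp: B_def a)
    then show ?thesis using card_succ[OF w a(1)] a Suc.prems by simp
  qed
  then have "(\<Sum>b\<in>B. card {a \<in> A. b \<in> N a}) = (k - 1) * card A"
    using fin by (intro sum_multicount) auto
  moreover have "card {a \<in> A. b \<in> N a} = 1" if "b \<in> B" for b
  proof -
    have b: "b \<in> V" "D z b = Suc i" "D w b = Suc (Suc i)" using that by (auto simp: B_def)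
    have "{a \<in> A. b \<in> N a} = {a \<in> N b. D z a < D z b}"
    proof (intro set_eqI iffI)
      fix a assume "a \<in> {a \<in> N b. D z a < D z b}"
      then have a: "a \<in> N b" "D z a < D z b" by auto
      then have aV: "a \<in> V" using N_in_V b by blast
      have "D z a = i" using D_step'[OF z(1) b(1) a(1)] a b by simp
      moreover have "D w a = Suc i"
        using D_step_left[OF z(1) aV z(2)] D_step'[OF w b(1) a(1)] b \<open>D z a = i\<close> by simp
      ultimately show "a \<in> {a \<in> A. b \<in> N a}" using a(1) aV N_sym[OF b(1) a(1)] by (simp add: A_def)
    next
      fix a assume "a \<in> {a \<in> A. b \<in> N a}"
      then have "a \<in> V" "D z a = i" "b \<in> N a" by (auto simp: A_def)
      then show "a \<in> {a \<in> N b. D z a < D z b}" using b N_sym[of a b] by simp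
    qed
    then show ?thesis using card_pred[OF z(1) b(1)] b Suc.prems by simp
  qed
  ultimately have "card B = (k - 1) * card A" by simp
  moreover have "card A = (k - 1) ^ i" using Suc by (simp add: A_def)
  ultimately show ?case by (simp add: B_def)
qed

lemma card_edge_half:
  assumes z: "z \<in> V" "w \<in> N z"
  shows "card {y \<in> V. D z y < d \<and> D w y = Suc (D z y)} = (\<Sum>i<d. (k - 1) ^ i)"
proof -
  have "{y \<in> V. D z y < d \<and> D w y = Suc (D z y)} = (\<Union>i<d. {y \<in> V. D z y = i \<and> D w y = Suc i})"
    by auto
  also have "card \<dots> = (\<Sum>i<d. card {y \<in> V. D z y = i \<and> D w y = Suc i})"
    using finite_V by (intro card_UN_disjoint) auto
  finally show ?thesis using card_edge_level[OF z] by simp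
qed

text \<open>The trees hanging off the two ends of the edge are disjoint and fill the Moore bound, so
  exactly the excess lies outside both.\<close>

lemma card_edge_far:
  assumes z: "z \<in> V" "w \<in> N z"
  shows "card {y \<in> V. d \<le> D z y \<and> d \<le> D w y} = 4"
proof -
  let ?X = "{y \<in> V. d \<le> D z y \<and> d \<le> D w y}"
  let ?A = "{y \<in> V. D z y < d \<and> D w y = Suc (D z y)}"
  let ?B = "{y \<in> V. D w y < d \<and> D z y = Suc (D w y)}"
  have w: "w \<in> V" "z \<in> N w" using z N_in_V N_sym[OF z] by auto
  have V: "V = ?X \<union> (?A \<union> ?B)"
  proof (intro equalityI subsetI)
    fix y assume y: "y \<in> V"
    have "d \<le> D z y \<and> d \<le> D w y \<or> D z y < d \<and> D w y = Suc (D z y) \<or> D w y < d \<and> D z y = Suc (D w y)"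
      using D_step_left[OF z(1) y z(2)] D_step_left'[OF z(1) y z(2)] level_edge_left[OF z y]
      by linarith
    then show "y \<in> ?X \<union> (?A \<union> ?B)" using y by simp
  qed auto
  have "?A \<inter> ?B = {}"
  proof (rule equals0I)
    fix y assume "y \<in> ?A \<inter> ?B"
    then have "D w y = Suc (D z y)" "D z y = Suc (D w y)" by blast+
    then show False by linarith
  qed
  then have "card (?A \<union> ?B) = card ?A + card ?B"
    by (intro card_Un_disjoint) (use finite_V in simp_all)
  moreover have "card (?X \<union> (?A \<union> ?B)) = card ?X + card (?A \<union> ?B)"
    by (rule card_Un_disjoint) (use finite_V in auto)
  ultimately have "card V = card ?X + (card ?A + card ?B)"
    using arg_cong[OF V, of card] by linarith
  then show ?thesis
    using card_V card_edge_half[OF z] card_edge_half[OF w] by simp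
qed

text \<open>The complements have equal size. For \<open>D z y = d\<close>, the pairs of a near
  neighbour \<open>w\<close> of \<open>z\<close> and a near neighbour \<open>y'\<close> of
  \<open>y\<close> with \<open>D w y' = d - 2\<close> form a perfect matching, because a vertex at
  distance \<open>d - 1\<close> has a single predecessor.\<close>

lemma card_far_nbrs:
  assumes z: "z \<in> V" "y \<in> V" "d \<le> D z y"
  shows "card {y' \<in> N y. d \<le> D z y'} = card {w \<in> N z. d \<le> D w y}"
proof -
  define S where "S = {w \<in> N z. D w y < d}"
  define R where "R = {y' \<in> N y. D z y' < d}"
  have fin: "finite S" "finite R" using finite_N z by (auto simp: S_def R_def)
  have "card S = card R"
  proof (cases "D z y = d")
    case False
    \<comment> \<open>From a distance above \<open>d\<close>, one step at either end does not lead
      below \<open>d\<close>.\<close>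
    then have "S = {}" "R = {}"
      using z D_step'[OF z(1,2)] D_step_left'[OF z(1,2)] by (force simp: S_def R_def)+
    then show ?thesis by simp
  next
    case True
    have row: "card {y' \<in> R. Suc (D w y') < d} = 1" if "w \<in> S" for w
    proof -
      have w: "w \<in> V" "w \<in> N z" "D w y < d" using that N_in_V z by (auto simp: S_def)
      have wd: "Suc (D w y) = d" using D_step_left'[OF z(1,2) w(2)] w True by simp
      have "{y' \<in> R. Suc (D w y') < d} = {y' \<in> N y. D w y' < D w y}"
      proof (intro set_eqI iffI)
        fix y' assume "y' \<in> {y' \<in> N y. D w y' < D w y}"
        then have y': "y' \<in> N y" "D w y' < D w y" "y' \<in> V" using N_in_V z by auto
        then show "y' \<in> {y' \<in> R. Suc (D w y') < d}"
          using D_step_left'[OF z(1) y'(3) w(2)] wd by (simp add: R_def)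
      qed (use wd in \<open>auto simp: R_def\<close>)
      then show ?thesis using card_pred[OF w(1) z(2)] wd d_ge by simp
    qed
    have col: "card {w \<in> S. Suc (D w y') < d} = 1" if "y' \<in> R" for y'
    proof -
      have y': "y' \<in> V" "y' \<in> N y" "D z y' < d" using that N_in_V z by (auto simp: R_def)
      have yd: "Suc (D z y') = d" using D_step'[OF z(1,2) y'(2)] y' True by simp
      have "{w \<in> S. Suc (D w y') < d} = {w \<in> N z. D y' w < D y' z}"
      proof (intro set_eqI iffI)
        fix w assume "w \<in> {w \<in> N z. D y' w < D y' z}"
        then have w: "w \<in> N z" "w \<in> V" "D w y' < D z y'"
          using N_in_V z D_sym y'(1) by auto
        then show "w \<in> {w \<in> S. Suc (D w y') < d}"
          using D_step'[OF w(2) z(2) y'(2)] yd by (simp add: S_def)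
      next
        fix w assume "w \<in> {w \<in> S. Suc (D w y') < d}"
        then have w: "w \<in> N z" "w \<in> V" "Suc (D w y') < d"
          using N_in_V z by (auto simp: S_def)
        then show "w \<in> {w \<in> N z. D y' w < D y' z}"
          using D_sym[OF y'(1) w(2)] D_sym[OF y'(1) z(1)] yd by simp
      qed
      then show ?thesis using card_pred[OF y'(1) z(1)] yd d_ge D_sym[OF y'(1) z(1)] by simp
    qed
    have "(\<Sum>w\<in>S. card {y' \<in> R. Suc (D w y') < d}) = 1 * card R"
      using fin col by (intro sum_multicount) auto
    then show ?thesis using row by simp
  qed
  moreover have "{y' \<in> N y. d \<le> D z y'} = N y - R" "{w \<in> N z. d \<le> D w y} = N z - S"
    by (auto simp: R_def S_def)
  moreover have "card (N y - R) = card (N y) - card R"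
    using fin(2) by (rule card_Diff_subset) (auto simp: R_def)
  moreover have "card (N z - S) = card (N z) - card S"
    using fin(1) by (rule card_Diff_subset) (auto simp: S_def)
  ultimately show ?thesis using z card_N by simp
qed


section \<open>Edges between vertices far from a fixed vertex\<close>

lemma D_N:
  assumes "v \<in> V" "w \<in> N v"
  shows "D v w = 1"
proof -
  have "w \<in> V" "w \<noteq> v" using assms N_in_V N_irrefl by auto
  then have "D v w \<noteq> 0" using D_eq_0 assms by blast
  moreover have "D v w \<le> Suc 0" using D_step[OF assms(1,1,2)] D_eq_0[OF assms(1,1)] by simp
  ultimately show ?thesis by simp
qed

text \<open>Otherwise \<open>y\<close> and \<open>y'\<close> would both be at distance
  \<open>d - 1\<close> from \<open>w\<close>, giving an edge inside a level below \<open>d\<close>.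
  So every neighbour of \<open>z\<close> is far from an end of each edge between far
  vertices.\<close>

lemma far_edge_cover:
  assumes "z \<in> V" "y \<in> V" "y' \<in> N y" "d \<le> D z y" "d \<le> D z y'" "w \<in> N z" "D w y < d"
  shows "d \<le> D w y'"
proof (rule ccontr)
  assume "\<not> d \<le> D w y'"
  moreover have "d \<le> Suc (D w y)" "d \<le> Suc (D w y')"
    using D_step_left'[OF assms(1,2,6)] D_step_left'[OF assms(1) N_in_V[OF assms(2,3)] assms(6)] assms(4,5)
    by auto
  ultimately have "D w y' = D w y" using assms(7) by linarith
  then show False
    using no_level_edge[OF N_in_V[OF assms(1,6)] assms(2,3)] assms(7) by linarith
qed

lemma far_nbrs_subset:
  assumes "z \<in> V" "y \<in> V" "d \<le> D z y" "w \<in> N z" "D w y < d"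
  shows "{y' \<in> N y. d \<le> D z y'} \<subseteq> {y' \<in> V. d \<le> D z y' \<and> d \<le> D w y'}"
  using far_edge_cover[OF assms(1,2)] assms N_in_V by blast

text \<open>Say that \<open>y\<close> misses the neighbours \<open>w\<close> of \<open>z\<close>
  with \<open>d \<le> D w y\<close>. They are as many as the far neighbours of \<open>y\<close>, and
  these lie among the four vertices far from an edge \<open>zw\<close> with
  \<open>D w y < d\<close>.\<close>

lemma card_missed_le:
  assumes "z \<in> V" "y \<in> V" "d \<le> D z y" "w \<in> N z" "D w y < d"
  shows "card {w \<in> N z. d \<le> D w y} \<le> 4"
proof -
  have "card {y' \<in> N y. d \<le> D z y'} \<le> card {y' \<in> V. d \<le> D z y' \<and> d \<le> D w y'}"
    using far_nbrs_subset[OF assms] finite_V by (intro card_mono) auto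
  then show ?thesis using card_far_nbrs[OF assms(1,2,3)] card_edge_far[OF assms(1,4)] by linarith
qed

lemma card_missed_sum:
  assumes "z \<in> V" "y \<in> V" "y' \<in> N y" "d \<le> D z y" "d \<le> D z y'"
  shows "k \<le> card {w \<in> N z. d \<le> D w y} + card {w \<in> N z. d \<le> D w y'}"
proof -
  have "N z = {w \<in> N z. d \<le> D w y} \<union> {w \<in> N z. d \<le> D w y'}"
    using far_edge_cover[OF assms] not_le by blast
  then have "card (N z) \<le> card {w \<in> N z. d \<le> D w y} + card {w \<in> N z. d \<le> D w y'}"
    by (metis card_Un_le)
  then show ?thesis using card_N assms(1) by simp
qed

lemma no_triangle: "v \<in> V \<Longrightarrow> a \<in> N v \<Longrightarrow> b \<in> N v \<Longrightarrow> b \<notin> N a"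
  using no_level_edge[of v a b] D_N[of v a] D_N[of v b] N_in_V[of v a] d_ge by auto

text \<open>A 4-cycle would give \<open>c\<close>, at distance 2 from \<open>v\<close>, two
  predecessors.\<close>

lemma common_nbrs_unique:
  assumes "v \<in> V" "a \<in> N v" "b \<in> N v" "c \<in> N a" "c \<in> N b" "c \<noteq> v"
  shows "a = b"
proof -
  have V: "a \<in> V" "b \<in> V" "c \<in> V" using assms N_in_V by blast+
  have "D v c \<noteq> 0" using D_eq_0 assms V by metis
  moreover have "D v c \<noteq> 1" using no_level_edge[OF assms(1) V(1) assms(4)] D_N[OF assms(1,2)] d_ge by auto
  moreover have "D v c \<le> 2" using D_step[OF assms(1) V(1) assms(4)] D_N[OF assms(1,2)] by simp
  ultimately have "D v c = 2" by linarith
  then show ?thesis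
    using unique_pred[OF assms(1) V(3) _ N_sym[OF V(1) assms(4)] N_sym[OF V(2) assms(5)]]
      D_N[OF assms(1,2)] D_N[OF assms(1,3)] d_ge by simp
qed

lemma obtain_other:
  assumes "3 \<le> card A"
  obtains b where "b \<in> A" "b \<noteq> a"
proof -
  have "finite A" using assms by (metis card.infinite not_numeral_le_zero)
  then have "\<not> A \<subseteq> {a}" using assms card_mono[of "{a}" A] by auto
  then show ?thesis using that by blast
qed

text \<open>The four vertices far from the edge \<open>zw\<close> are then exactly the far neighbours of \<open>y\<close>, which yields a 4-cycle through \<open>y\<close>.\<close>

lemma far_edge_aux:
  assumes z: "z \<in> V" "y \<in> V" "y' \<in> N y" "d \<le> D z y" "d \<le> D z y'"
    and w: "w \<in> N z" "D w y < d" and w': "w' \<in> N z" "D w' y' < d"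
    and four: "card {w \<in> N z. d \<le> D w y} = 4"
  shows False
proof -
  define F where "F x = {x' \<in> N x. d \<le> D z x'}" for x
  have y': "y' \<in> V" "y \<in> N y'" using z N_in_V N_sym[OF z(2,3)] by auto
  have cF: "card (F x) = card {w \<in> N z. d \<le> D w x}" if "x \<in> V" "d \<le> D z x" for x
    using card_far_nbrs that z by (simp add: F_def)
  have Fy: "F y = {x \<in> V. d \<le> D z x \<and> d \<le> D w0 x}" if "w0 \<in> N z" "D w0 y < d" for w0
  proof (rule card_subset_eq)
    show "F y \<subseteq> {x \<in> V. d \<le> D z x \<and> d \<le> D w0 x}"
      unfolding F_def using far_nbrs_subset[OF z(1,2,4) that] .
    show "card (F y) = card {x \<in> V. d \<le> D z x \<and> d \<le> D w0 x}"
      using card_edge_far[OF z(1) that(1)] cF[OF z(2,4)] four by simp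
  qed (use finite_V in simp)
  \<comment> \<open>\<open>y\<close> and \<open>y'\<close> together miss at least
    \<open>k \<ge> 7\<close> neighbours of \<open>z\<close>, and \<open>y\<close> misses
    four.\<close>
  have "3 \<le> card (F y')"
    using card_missed_sum[OF z] four k_ge cF[OF y'(1) z(5)] by linarith
  then obtain x where x: "x \<in> F y'" "x \<noteq> y" by (rule obtain_other)
  then have xV: "x \<in> V" "x \<in> N y'" "d \<le> D z x" using y' N_in_V by (auto simp: F_def)
  have "x \<notin> N y" using no_triangle[OF z(2) z(3)] xV by blast
  then have hit: "D w0 x < d" if "w0 \<in> N z" "D w0 y < d" for w0
    using Fy[OF that] xV by (auto simp: F_def not_le[symmetric])
  \<comment> \<open>\<open>x\<close> lies outside \<open>F y\<close>, hence is near \<open>w\<close>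
    just as \<open>y\<close> is, and \<open>F x\<close> falls into the same set of four. An element
    \<open>u\<close> of \<open>F x\<close> other than \<open>y'\<close> then closes the 4-cycle
    \<open>y\<close>, \<open>y'\<close>, \<open>x\<close>, \<open>u\<close>.\<close>
  have "F x \<subseteq> F y"
    unfolding Fy[OF w] using far_nbrs_subset[OF z(1) xV(1,3) w(1) hit[OF w]] by (simp add: F_def)
  have "3 \<le> card (F x)"
    using card_missed_sum[OF z(1) y'(1) xV(2) z(5) xV(3)] card_missed_le[OF z(1) y'(1) z(5) w']
      k_ge cF[OF xV(1,3)] by linarith
  then obtain u where u: "u \<in> F x" "u \<noteq> y'" by (rule obtain_other)
  then have "u \<in> N x" "u \<in> N y" using \<open>F x \<subseteq> F y\<close> by (auto simp: F_def)
  then show False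
    using common_nbrs_unique[OF z(2) _ z(3) N_sym[OF xV(1)] xV(2) x(2)] u(2) by blast
qed

lemma far_edge:
  assumes z: "z \<in> V" "y \<in> V" "y' \<in> N y" "d \<le> D z y" "d \<le> D z y'"
  shows "d < D z y \<or> d < D z y'"
proof (rule ccontr)
  assume "\<not> ?thesis"
  then have eq: "D z y = d" "D z y' = d" using z by auto
  have y': "y' \<in> V" "y \<in> N y'" using z N_in_V N_sym[OF z(2,3)] by auto
  have ex: "\<exists>w \<in> N z. D w x < d" if "x \<in> V" "D z x = d" for x
    using D_pred[OF that(1) z(1)] that d_ge D_sym z(1) N_in_V by fastforce
  obtain w w' where w: "w \<in> N z" "D w y < d" "w' \<in> N z" "D w' y' < d"
    using ex z(2) y'(1) eq by metis
  \<comment> \<open>Both counts are at most 4 and add up to at least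
    \<open>k \<ge> 7\<close>.\<close>
  have "card {w \<in> N z. d \<le> D w y} = 4 \<or> card {w \<in> N z. d \<le> D w y'} = 4"
    using card_missed_sum[OF z] card_missed_le[OF z(1,2,4) w(1,2)]
      card_missed_le[OF z(1) y'(1) z(5) w(3,4)] k_ge by linarith
  then show False
    using far_edge_aux[OF z w] far_edge_aux[OF z(1) y' z(5,4) w(3,4,1,2)] by blast
qed

text \<open>The far neighbours, counted over all far vertices, number \<open>4 * k\<close>. Every
  neighbour of a vertex in \<open>K\<close> is far, while by \<open>far_edge\<close> the far
  neighbours of a vertex outside \<open>K\<close> are those in \<open>K\<close>. With
  \<open>e\<close> twice the number of edges inside \<open>K\<close> this gives
  \<open>4 * k + e = 2 * (card K * k)\<close>.\<close>

lemma far_vertices: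
  assumes z: "z \<in> V"
  defines "K \<equiv> {y \<in> V. d < D z y}"
  shows "card K = 2" and "\<And>x. x \<in> K \<Longrightarrow> N x \<inter> K = {}"
proof -
  define F where "F = {y \<in> V. d \<le> D z y}"
  have fin: "finite K" "finite F" "finite (F - K)" using finite_V by (auto simp: K_def F_def)
  have KF: "K \<subseteq> F" by (auto simp: K_def F_def)
  \<comment> \<open>Each of the \<open>k\<close> neighbours \<open>w\<close> of \<open>z\<close>
    contributes the four vertices far from the edge \<open>zw\<close>; \<open>card_far_nbrs\<close>
    then turns missed neighbours into far neighbours.\<close>
  have "(\<Sum>y\<in>F. card {w \<in> N z. d \<le> D w y}) = 4 * card (N z)"
    using fin finite_N[OF z] card_edge_far[OF z] by (intro sum_multicount) (auto simp: F_def conj_assoc)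
  moreover have "(\<Sum>y\<in>F. card {w \<in> N z. d \<le> D w y}) = (\<Sum>y\<in>F. card {y' \<in> N y. d \<le> D z y'})"
    using card_far_nbrs[OF z] by (intro sum.cong) (auto simp: F_def)
  ultimately have "(\<Sum>y\<in>F. card {y' \<in> N y. d \<le> D z y'}) = 4 * k"
    using card_N z by simp
  moreover have "(\<Sum>y\<in>F. card {y' \<in> N y. d \<le> D z y'})
      = (\<Sum>y\<in>F - K. card {y' \<in> N y. d \<le> D z y'}) + (\<Sum>y\<in>K. card {y' \<in> N y. d \<le> D z y'})"
    using sum.subset_diff[OF KF fin(2)] .
  moreover have "(\<Sum>y\<in>K. card {y' \<in> N y. d \<le> D z y'}) = (\<Sum>y\<in>K. k)"
  proof (rule sum.cong[OF refl])
    fix x assume "x \<in> K"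
    then have x: "x \<in> V" "d < D z x" by (auto simp: K_def)
    then have "{y' \<in> N x. d \<le> D z y'} = N x" using D_step'[OF z x(1)] by fastforce
    then show "card {y' \<in> N x. d \<le> D z y'} = k" using card_N x by simp
  qed
  moreover have "(\<Sum>y\<in>F - K. card {y' \<in> N y. d \<le> D z y'}) = (\<Sum>y\<in>F - K. card {x \<in> K. x \<in> N y})"
  proof (rule sum.cong[OF refl])
    fix y assume "y \<in> F - K"
    then have y: "y \<in> V" "D z y = d" by (auto simp: F_def K_def)
    have "{y' \<in> N y. d \<le> D z y'} = {x \<in> K. x \<in> N y}"
      using far_edge[OF z y(1)] y N_in_V[OF y(1)] by (auto simp: K_def)
    then show "card {y' \<in> N y. d \<le> D z y'} = card {x \<in> K. x \<in> N y}" by simp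
  qed
  moreover have "(\<Sum>y\<in>F - K. card {x \<in> K. x \<in> N y}) = (\<Sum>x\<in>K. card {y \<in> F - K. x \<in> N y})"
    by (rule sum_multicount_gen) (use fin in auto)
  moreover have "(\<Sum>x\<in>K. card {y \<in> F - K. x \<in> N y}) = (\<Sum>x\<in>K. card (N x - K))"
  proof (rule sum.cong[OF refl])
    fix x assume "x \<in> K"
    then have x: "x \<in> V" "d < D z x" by (auto simp: K_def)
    have "{y \<in> F - K. x \<in> N y} = N x - K"
    proof (intro set_eqI iffI)
      fix y assume "y \<in> {y \<in> F - K. x \<in> N y}"
      then show "y \<in> N x - K" using N_sym[of y x] by (auto simp: F_def)
    next
      fix y assume "y \<in> N x - K"
      then show "y \<in> {y \<in> F - K. x \<in> N y}"
        using N_sym[OF x(1), of y] N_in_V[OF x(1), of y] D_step'[OF z x(1), of y] x by (auto simp: F_def)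
    qed
    then show "card {y \<in> F - K. x \<in> N y} = card (N x - K)" by simp
  qed
  moreover have "(\<Sum>x\<in>K. card (N x - K)) + (\<Sum>x\<in>K. card (N x \<inter> K)) = (\<Sum>x\<in>K. k)"
    unfolding sum.distrib[symmetric]
  proof (rule sum.cong[OF refl])
    fix x assume "x \<in> K"
    then have "x \<in> V" by (auto simp: K_def)
    then show "card (N x - K) + card (N x \<inter> K) = k"
      using card_Int_Diff[OF finite_N, of x K] card_N by simp
  qed
  moreover define e where "e = (\<Sum>x\<in>K. card (N x \<inter> K))"
  ultimately have e: "4 * k + e = 2 * (card K * k)" "card K * k \<le> 4 * k"
    unfolding sum_constant of_nat_id by linarith+
  have "e \<le> (\<Sum>x\<in>K. card K - 1)"
    unfolding e_def
  proof (rule sum_mono)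
    fix x assume x: "x \<in> K"
    then have "N x \<inter> K \<subseteq> K - {x}" using N_irrefl[of x] by (auto simp: K_def)
    then show "card (N x \<inter> K) \<le> card K - 1"
      using card_mono[of "K - {x}" "N x \<inter> K"] fin x by simp
  qed
  then have e2: "e \<le> card K * (card K - 1)" by simp
  have "card K \<le> 4" using e(2) k_ge by simp
  then consider "card K = 0" | "card K = 1" | "card K = 2" | "card K = 3" | "card K = 4" by linarith
  \<comment> \<open>Fewer than two vertices make the right-hand side of the equation too small;
    three or four would force \<open>e = 2 * k\<close> or \<open>e = 4 * k\<close>, more than
    \<open>card K * (card K - 1)\<close>.\<close>
  then have "card K = 2 \<and> e = 0" by cases (use e(1) e2 k_ge in auto)
  then show "card K = 2" "\<And>x. x \<in> K \<Longrightarrow> N x \<inter> K = {}"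
    using fin finite_V by (auto simp: e_def)
qed

text \<open>A vertex beyond \<open>d + 1\<close> would be adjacent to another vertex beyond
  \<open>d\<close>, but those are pairwise nonadjacent. This also excludes default distances, so the
  graph is connected.\<close>

lemma D_le:
  assumes z: "z \<in> V" "y \<in> V"
  shows "D z y \<le> Suc d"
proof (rule ccontr)
  assume "\<not> ?thesis"
  then have y: "Suc d < D z y" by simp
  have "N y \<noteq> {}" using card_N[OF z(2)] k_ge by auto
  then obtain x where x: "x \<in> N y" "x \<in> V" using N_in_V z by blast
  then have "d < D z x" using D_step'[OF z x(1)] y by linarith
  then show False using far_vertices(2)[OF z(1), of y] z x y by auto
qed

lemma card_antipodal:
  assumes "z \<in> V"
  shows "card {y \<in> V. D z y = Suc d} = 2"
proof -
  have "{y \<in> V. D z y = Suc d} = {y \<in> V. d < D z y}" using D_le[OF assms] by force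
  then show ?thesis using far_vertices(1)[OF assms] by simp
qed

text \<open>Below level \<open>d\<close> this is the girth condition, in level \<open>d\<close> it
  is \<open>far_edge\<close>, and beyond it the independence of the remaining vertices.\<close>

lemma D_nbr_neq:
  assumes "z \<in> V" "y \<in> V" "x \<in> N y"
  shows "D z x \<noteq> D z y"
proof
  assume eq: "D z x = D z y"
  then have "d \<le> D z y" using no_level_edge assms by metis
  then have "d < D z y" using far_edge[OF assms] eq by simp
  then show False using far_vertices(2)[OF assms(1), of y] assms eq N_in_V by auto
qed

end

section \<open>Adjacency and antipodality operators\<close>

interpretation fn: vector_space "\<lambda>(c :: 'c::field) (f :: 'a \<Rightarrow> 'c) x. c * f x"
  by unfold_locales (auto simp: fun_eq_iff algebra_simps)

context moore_distance
begin

lemma D_self [simp]: "v \<in> V \<Longrightarrow> D v v = 0"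
  using D_eq_0 by blast

text \<open>Bipartiteness in the form in which it is used: along a shortest path from
  \<open>u\<close> to \<open>v\<close> each edge changes the parity of the distance to
  \<open>z\<close>.\<close>

lemma D_parity:
  assumes "z \<in> V" "u \<in> V" "v \<in> V"
  shows "even (D u v + (D z u + D z v))"
  using assms(3)
proof (induction "D u v" arbitrary: v rule: less_induct)
  case less
  show ?case
  proof (cases "D u v = 0")
    case True
    then show ?thesis using D_eq_0 assms less.prems by simp
  next
    case False
    then obtain w where w: "w \<in> N v" "D u w < D u v"
      using D_pred[OF assms(2) less.prems] D_le[OF assms(2) less.prems] by auto
    have wV: "w \<in> V" using w less.prems N_in_V by blast
    have "D u v = Suc (D u w)" using D_step'[OF assms(2) less.prems w(1)] w(2) by simp
    moreover have "D z v = Suc (D z w) \<or> D z w = Suc (D z v)"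
      using D_step[OF assms(1) less.prems w(1)] D_step'[OF assms(1) less.prems w(1)]
        D_nbr_neq[OF assms(1) less.prems w(1)] by linarith
    ultimately show ?thesis using less.hyps[OF w(2) wV] by auto
  qed
qed

text \<open>The sign distinguishing the two halves of the bipartition. The base vertex is arbitrary;
  \<open>\<sigma> u * \<sigma> v\<close> does not depend on it.\<close>

definition \<sigma> :: "'a \<Rightarrow> 'c::comm_ring_1" where
  "\<sigma> v = (-1) ^ D (SOME z. z \<in> V) v"

lemma V_ne: "V \<noteq> {}"
  using card_V by auto

lemma \<sigma>_mult: "u \<in> V \<Longrightarrow> v \<in> V \<Longrightarrow> (\<sigma> u * \<sigma> v :: 'c::comm_ring_1) = (-1) ^ D u v"
  using D_parity[of "SOME z. z \<in> V" u v] V_ne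
  by (auto simp: \<sigma>_def some_in_eq minus_one_power_iff)

lemma \<sigma>_square [simp]: "(\<sigma> v * \<sigma> v :: 'c::comm_ring_1) = 1"
  by (simp add: \<sigma>_def minus_one_power_iff)

text \<open>This operator and the next two return 0 outside \<open>V\<close>, so their values are
  again functions supported on \<open>V\<close>.\<close>

definition Aop :: "('a \<Rightarrow> 'c::comm_ring_1) \<Rightarrow> 'a \<Rightarrow> 'c" where
  "Aop f v = (if v \<in> V then \<Sum>u\<in>N v. f u else 0)"

definition Eop :: "('a \<Rightarrow> 'c::comm_ring_1) \<Rightarrow> 'a \<Rightarrow> 'c" where
  "Eop f v = (if v \<in> V then \<Sum>u\<in>{u \<in> V. D v u = Suc d}. f u else 0)"

text \<open>The sum over the distances \<open>i\<close>, \<open>i - 2\<close>, and so on: what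
  \<open>geo\<close> with parameter \<open>k - 1\<close> becomes at \<open>Aop\<close> for
  \<open>i < d\<close>.\<close>

definition Sop :: "nat \<Rightarrow> ('a \<Rightarrow> 'c::comm_ring_1) \<Rightarrow> 'a \<Rightarrow> 'c" where
  "Sop i f v = (if v \<in> V then \<Sum>u\<in>{u \<in> V. D v u \<le> i \<and> even (i + D v u)}. f u else 0)"

text \<open>If \<open>D v u\<close> has the parity of \<open>i\<close> and is at most
  \<open>i\<close>, all \<open>k = 1 + (k - 1)\<close> neighbours count; at distance
  \<open>i + 2 < d\<close> only the unique predecessor does; otherwise none.\<close>

lemma card_Sop_step:
  assumes "v \<in> V" "u \<in> V" "Suc (Suc i) < d"
  shows "card {w \<in> N v. D w u \<le> Suc i \<and> even (Suc i + D w u)} =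
    (if D v u \<le> Suc (Suc i) \<and> even (Suc (Suc i) + D v u) then 1 else 0)
    + (k - 1) * (if D v u \<le> i \<and> even (i + D v u) then 1 else 0)"
proof -
  have nb: "D w u = Suc (D v u) \<or> D v u = Suc (D w u)" if "w \<in> N v" for w
    using D_step_left[OF assms(1,2) that] D_step_left'[OF assms(1,2) that]
      D_nbr_neq[OF assms(2,1) that] D_sym[OF assms(2,1)] D_sym[OF assms(2) N_in_V[OF assms(1) that]]
    by linarith
  consider "odd (i + D v u)" | "even (i + D v u)" "D v u \<le> i" | "D v u = Suc (Suc i)"
    | "even (i + D v u)" "D v u > Suc (Suc i)"
  proof -
    have "D v u \<noteq> Suc i" if "even (i + D v u)" using that by auto
    then show ?thesis using that by (cases "even (i + D v u)") linarith+
  qed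
  then show ?thesis
  proof cases
    case 1
    then have *: "{w \<in> N v. D w u \<le> Suc i \<and> even (Suc i + D w u)} = {}"
      using nb by fastforce
    show ?thesis unfolding * using 1 by simp
  next
    case 2
    then have "{w \<in> N v. D w u \<le> Suc i \<and> even (Suc i + D w u)} = N v"
      using nb by fastforce
    then show ?thesis using 2 card_N assms k_ge by simp
  next
    case 3
    have "{w \<in> N v. D w u \<le> Suc i \<and> even (Suc i + D w u)} = {w \<in> N v. D u w < D u v}"
    proof (intro Collect_cong conj_cong refl)
      fix w assume w: "w \<in> N v"
      have "D u w = D w u" "D u v = D v u"
        using D_sym[OF assms(2)] N_in_V[OF assms(1) w] assms(1) by auto
      then show "(D w u \<le> Suc i \<and> even (Suc i + D w u)) = (D u w < D u v)"
        using nb[OF w] 3 by presburger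
    qed
    then show ?thesis
      using card_pred[OF assms(2,1)] 3 D_sym[OF assms(2,1)] assms by simp
  next
    case 4
    then have *: "{w \<in> N v. D w u \<le> Suc i \<and> even (Suc i + D w u)} = {}"
      using nb by fastforce
    show ?thesis unfolding * using 4 by simp
  qed
qed

text \<open>The recurrence of \<open>geo\<close>, read for operators; exchanging the sums reduces it
  to the count in \<open>card_Sop_step\<close>.\<close>

lemma Aop_Sop:
  fixes f :: "'a \<Rightarrow> 'c::comm_ring_1"
  assumes "Suc (Suc i) < d"
  shows "Aop (Sop (Suc i) f) v = Sop (Suc (Suc i)) f v + of_nat (k - 1) * Sop i f v"
proof (cases "v \<in> V")
  case True
  define P where "P i w u \<longleftrightarrow> D w u \<le> i \<and> even (i + D w u)" for i w u
  have S: "Sop i f w = (\<Sum>u\<in>V. if P i w u then f u else 0)" if "w \<in> V" for i w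
    using that finite_V by (simp add: Sop_def P_def sum.inter_filter)
  have "Aop (Sop (Suc i) f) v = (\<Sum>w\<in>N v. \<Sum>u\<in>V. if P (Suc i) w u then f u else 0)"
    using True N_in_V S by (auto simp: Aop_def intro!: sum.cong)
  also have "\<dots> = (\<Sum>u\<in>V. \<Sum>w\<in>N v. if P (Suc i) w u then f u else 0)"
    by (rule sum.swap)
  also have "\<dots> = (\<Sum>u\<in>V. (if P (Suc (Suc i)) v u then f u else 0)
      + of_nat (k - 1) * (if P i v u then f u else 0))"
  proof (rule sum.cong[OF refl])
    fix u assume u: "u \<in> V"
    have "(\<Sum>w\<in>N v. if P (Suc i) w u then f u else 0) = of_nat (card {w \<in> N v. P (Suc i) w u}) * f u"
      using finite_N[OF True] by (simp add: sum.inter_filter[symmetric])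
    also have "card {w \<in> N v. P (Suc i) w u} =
        (if P (Suc (Suc i)) v u then 1 else 0) + (k - 1) * (if P i v u then 1 else 0)"
      unfolding P_def using card_Sop_step[OF True u assms] .
    finally show "(\<Sum>w\<in>N v. if P (Suc i) w u then f u else 0) = (if P (Suc (Suc i)) v u then f u else 0)
      + of_nat (k - 1) * (if P i v u then f u else 0)"
      by (simp add: algebra_simps)
  qed
  also have "\<dots> = Sop (Suc (Suc i)) f v + of_nat (k - 1) * Sop i f v"
    using S True by (simp add: sum.distrib sum_distrib_left)
  finally show ?thesis .
qed (simp add: Aop_def Sop_def)

lemma Sop_0: "(\<And>v. v \<notin> V \<Longrightarrow> f v = 0) \<Longrightarrow> Sop 0 f = f"
proof (rule ext)
  fix v assume f: "\<And>v. v \<notin> V \<Longrightarrow> f v = 0"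
  show "Sop 0 f v = f v"
  proof (cases "v \<in> V")
    case True
    then have "{u \<in> V. D v u \<le> 0 \<and> even (0 + D v u)} = {v}" using D_eq_0 by auto
    then show ?thesis using True by (simp add: Sop_def)
  qed (simp add: Sop_def f)
qed

lemma N_eq: "v \<in> V \<Longrightarrow> {u \<in> V. D v u = 1} = N v"
proof (intro set_eqI iffI)
  fix u assume v: "v \<in> V" and "u \<in> {u \<in> V. D v u = 1}"
  then have u: "u \<in> V" "D v u = 1" by auto
  then obtain w where w: "w \<in> N u" "D v w < 1" using D_pred[OF v u(1)] d_ge by auto
  then have "w = v" using D_eq_0[OF v N_in_V[OF u(1) w(1)]] by simp
  then show "u \<in> N v" using w N_sym[OF u(1)] by blast
qed (use N_in_V D_N in auto)

lemma Sop_1: "Sop (Suc 0) f = Aop f"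
proof (rule ext)
  fix v
  show "Sop (Suc 0) f v = Aop f v"
  proof (cases "v \<in> V")
    case True
    have "{u \<in> V. D v u \<le> Suc 0 \<and> even (Suc 0 + D v u)} = {u \<in> V. D v u = 1}"
      by (auto simp: le_Suc_eq)
    then show ?thesis using True N_eq by (simp add: Sop_def Aop_def)
  qed (simp add: Sop_def Aop_def)
qed

lemma sum_Aop:
  fixes f :: "'a \<Rightarrow> 'c::comm_ring_1"
  shows "(\<Sum>v\<in>V. Aop f v) = of_nat k * (\<Sum>v\<in>V. f v)"
proof -
  have "(\<Sum>v\<in>V. Aop f v) = (\<Sum>v\<in>V. \<Sum>u\<in>V. if u \<in> N v then f u else 0)"
    using N_subset finite_V
    by (intro sum.cong) (auto simp: Aop_def sum.inter_restrict[symmetric] Int_absorb1)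
  also have "\<dots> = (\<Sum>u\<in>V. \<Sum>v\<in>V. if u \<in> N v then f u else 0)" by (rule sum.swap)
  also have "\<dots> = (\<Sum>u\<in>V. of_nat k * f u)"
  proof (rule sum.cong[OF refl])
    fix u assume u: "u \<in> V"
    have "{v \<in> V. u \<in> N v} = N u" using N_sym N_in_V u by blast
    then show "(\<Sum>v\<in>V. if u \<in> N v then f u else 0) = of_nat k * f u"
      using u finite_V card_N by (simp add: sum.inter_filter[symmetric])
  qed
  finally show ?thesis by (simp add: sum_distrib_left)
qed

lemma sum_Eop:
  fixes f :: "'a \<Rightarrow> 'c::comm_ring_1"
  shows "(\<Sum>v\<in>V. Eop f v) = 2 * (\<Sum>v\<in>V. f v)"
proof -
  have "(\<Sum>v\<in>V. Eop f v) = (\<Sum>v\<in>V. \<Sum>u\<in>V. if D v u = Suc d then f u else 0)"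
    using finite_V by (intro sum.cong) (auto simp: Eop_def sum.inter_filter[symmetric])
  also have "\<dots> = (\<Sum>u\<in>V. \<Sum>v\<in>V. if D v u = Suc d then f u else 0)" by (rule sum.swap)
  also have "\<dots> = (\<Sum>u\<in>V. 2 * f u)"
  proof (rule sum.cong[OF refl])
    fix u assume u: "u \<in> V"
    have "{v \<in> V. D v u = Suc d} = {v \<in> V. D u v = Suc d}" using D_sym u by auto
    then show "(\<Sum>v\<in>V. if D v u = Suc d then f u else 0) = 2 * f u"
      using u finite_V card_antipodal by (simp add: sum.inter_filter[symmetric])
  qed
  finally show ?thesis by (simp add: sum_distrib_left)
qed

text \<open>Edges join different halves, so the sign anticommutes with adjacency.\<close>

lemma \<sigma>_Aop: "\<sigma> v * Aop f v = - Aop (\<lambda>u. \<sigma> u * f u) v" for f :: "'a \<Rightarrow> 'c::comm_ring_1"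
proof (cases "v \<in> V")
  case True
  have "\<sigma> v * f u = - (\<sigma> u * f u)" if "u \<in> N v" for u
  proof -
    have "\<sigma> v * \<sigma> u = (-1 :: 'c)" using \<sigma>_mult[OF True N_in_V[OF True that]] D_N[OF True that] by simp
    then have "\<sigma> v = - (\<sigma> u :: 'c)" by (metis \<sigma>_square mult.assoc mult.right_neutral mult_minus1)
    then show ?thesis by simp
  qed
  then show ?thesis using True by (simp add: Aop_def sum_distrib_left sum_negf[symmetric])
qed (simp add: Aop_def)

lemma \<sigma>_Eop: "\<sigma> v * Eop f v = (-1) ^ Suc d * Eop (\<lambda>u. \<sigma> u * f u) v" for f :: "'a \<Rightarrow> 'c::comm_ring_1"
proof (cases "v \<in> V")
  case True
  have "\<sigma> v * f u = (-1) ^ Suc d * (\<sigma> u * f u)" if "u \<in> V" "D v u = Suc d" for u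
  proof -
    have "\<sigma> v * \<sigma> u = ((-1) ^ Suc d :: 'c)" using \<sigma>_mult[OF True that(1)] that by simp
    then have "\<sigma> v = (-1) ^ Suc d * (\<sigma> u :: 'c)" by (metis \<sigma>_square mult.assoc mult.right_neutral)
    then show ?thesis by (simp add: mult.assoc)
  qed
  then show ?thesis using True by (simp add: Eop_def sum_distrib_left)
qed (simp add: Eop_def)

text \<open>Distances are at most \<open>d + 1\<close> and \<open>d\<close> has the wrong parity, so
  \<open>Sop (d - 1)\<close> and \<open>Eop\<close> together sum \<open>f\<close> over one half of
  the bipartition. The two hypotheses make each such sum vanish.\<close>

lemma Sop_Eop:
  fixes f :: "'a \<Rightarrow> 'c::linordered_field"
  assumes "(\<Sum>v\<in>V. f v) = 0" "(\<Sum>v\<in>V. \<sigma> v * f v) = 0"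
  shows "Sop (d - 1) f v = - Eop f v"
proof (cases "v \<in> V")
  case True
  let ?A = "{u \<in> V. D v u \<le> d - 1 \<and> even (d - 1 + D v u)}" and ?B = "{u \<in> V. D v u = Suc d}"
  have "Sop (d - 1) f v + Eop f v = (\<Sum>u\<in>?A \<union> ?B. f u)"
    using True finite_V by (subst sum.union_disjoint) (auto simp: Sop_def Eop_def)
  also have "?A \<union> ?B = {u \<in> V. even (d - 1 + D v u)}"
  proof (intro set_eqI iffI)
    fix u assume u: "u \<in> {u \<in> V. even (d - 1 + D v u)}"
    then have "D v u \<le> Suc d" "D v u \<noteq> d" using D_le[OF True] d_ge by auto
    then show "u \<in> ?A \<union> ?B" using u by auto
  qed (use d_ge in auto)
  also have "(\<Sum>u\<in>\<dots>. f u) = (\<Sum>u\<in>V. if even (d - 1 + D v u) then f u else 0)"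
    using finite_V by (rule sum.inter_filter)
  \<comment> \<open>The indicator of a half is the average of the constant 1 and
    \<open>\<sigma>\<close> up to sign.\<close>
  also have "\<dots> = (\<Sum>u\<in>V. (f u + (-1) ^ (d - 1) * \<sigma> v * (\<sigma> u * f u)) / 2)"
  proof (rule sum.cong[OF refl])
    fix u assume u: "u \<in> V"
    have *: "(-1) ^ (d - 1) * \<sigma> v * (\<sigma> u * f u) = (-1) ^ (d - 1 + D v u) * f u"
      using \<sigma>_mult[OF True u, where 'c='c] by (metis (no_types) mult.assoc power_add)
    show "(if even (d - 1 + D v u) then f u else 0) = (f u + (-1) ^ (d - 1) * \<sigma> v * (\<sigma> u * f u)) / 2"
      unfolding * by (simp add: minus_one_power_iff)
  qed
  also have "\<dots> = 0"
    using assms by (simp add: sum_divide_distrib[symmetric] sum.distrib sum_distrib_left[symmetric])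
  finally show ?thesis by (simp add: eq_neg_iff_add_eq_0)
qed (simp add: Sop_def Eop_def)

end

lemma sum_fun_apply: "(\<Sum>i\<in>I. f i) x = (\<Sum>i\<in>I. f i x)" for f :: "'i \<Rightarrow> 'a \<Rightarrow> 'c::comm_monoid_add"
  by (induction I rule: infinite_finite_induct) auto

context moore_distance
begin

lemma Aop_add: "Aop (f + g) = Aop f + Aop g"
  by (auto simp: Aop_def fun_eq_iff sum.distrib)

lemma Aop_scale: "Aop (\<lambda>x. c * f x) = (\<lambda>x. c * Aop f x)"
  by (auto simp: Aop_def fun_eq_iff sum_distrib_left)

lemma Eop_add: "Eop (f + g) = Eop f + Eop g"
  by (auto simp: Eop_def fun_eq_iff sum.distrib)

lemma Eop_scale: "Eop (\<lambda>x. c * f x) = (\<lambda>x. c * Eop f x)"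
  by (auto simp: Eop_def fun_eq_iff sum_distrib_left)

interpretation A: vector_space_endo "\<lambda>(c :: 'c::field) (f :: 'a \<Rightarrow> 'c) x. c * f x" Aop
  by unfold_locales (rule Aop_add Aop_scale)+

lemma poly_op_geo:
  assumes "\<And>v. v \<notin> V \<Longrightarrow> f v = 0" "i < d"
  shows "A.poly_op (geo (of_nat (k - 1)) i) f = Sop i f"
  using assms(2)
proof (induction i rule: induct_nat_012)
  case 0
  have "A.poly_op 1 f = f" by (simp add: A.poly_op_def)
  then show ?case using Sop_0[of f] assms(1) by simp
next
  case 1
  have "A.poly_op [:0, 1:] f = Aop f" by (simp add: A.poly_op_pCons fun_eq_iff)
  then show ?case by (simp add: Sop_1)
next
  case (ge2 i)
  then have "A.poly_op (geo (of_nat (k - 1)) (Suc (Suc i))) f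
      = Aop (Sop (Suc i) f) - (\<lambda>x. of_nat (k - 1) * Sop i f x)"
    by (simp add: A.poly_op_diff A.poly_op_smult A.poly_op_pCons) (simp add: fun_eq_iff)
  then show ?case using Aop_Sop[OF ge2.prems, of f] by (simp add: fun_eq_iff)
qed

lemma poly_op_Aop: "A.poly_op p (Aop f) = Aop (A.poly_op p f)" for f :: "'a \<Rightarrow> 'c::field"
proof -
  have "A.poly_op [:0, 1:] g = Aop g" for g :: "'a \<Rightarrow> 'c"
    by (simp add: A.poly_op_pCons fun_eq_iff)
  then show ?thesis
    using A.poly_op_mult[of p "[:0, 1:]" f] A.poly_op_mult[of "[:0, 1:]" p f]
    by (simp only: mult.commute[of p])
qed

section \<open>Eigenspaces of the antipodality operator\<close>

definition supported :: "('a \<Rightarrow> 'c::zero) set" where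
  "supported = {f. \<forall>v. v \<notin> V \<longrightarrow> f v = 0}"

definition Esp :: "'c::comm_ring_1 \<Rightarrow> ('a \<Rightarrow> 'c) set" where
  "Esp s = {f \<in> supported. Eop f = (\<lambda>x. s * f x)}"

text \<open>Over an ordered field the two conditions say that \<open>f\<close> sums to zero on each
  half.\<close>

definition Wsp :: "'c::comm_ring_1 \<Rightarrow> ('a \<Rightarrow> 'c) set" where
  "Wsp s = {f \<in> Esp s. (\<Sum>v\<in>V. f v) = 0 \<and> (\<Sum>v\<in>V. \<sigma> v * f v) = 0}"

definition delta :: "'a \<Rightarrow> 'a \<Rightarrow> 'c::zero_neq_one" where
  "delta v x = (if x = v then 1 else 0)"

lemma supported_span: "supported \<subseteq> fn.span (delta ` V :: ('a \<Rightarrow> 'c::field) set)"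
proof
  fix f :: "'a \<Rightarrow> 'c" assume f: "f \<in> supported"
  have "f = (\<Sum>v\<in>V. (\<lambda>x. f v * delta v x))"
  proof
    fix x
    have "(\<Sum>v\<in>V. f v * delta v x) = (if x \<in> V then f x else 0)"
      using finite_V by (simp add: delta_def if_distrib[of "times _"] cong: if_cong)
    then show "f x = (\<Sum>v\<in>V. (\<lambda>x. f v * delta v x)) x"
      using f finite_V by (simp add: sum_fun_apply supported_def)
  qed
  also have "\<dots> \<in> fn.span (delta ` V)"
    by (intro fn.span_sum fn.span_scale fn.span_base) auto
  finally show "f \<in> fn.span (delta ` V)" .
qed

lemma Eop_0: "Eop 0 = 0"
  by (auto simp: Eop_def fun_eq_iff)

lemma Esp_subspace: "fn.subspace (Esp s :: ('a \<Rightarrow> 'c::field) set)"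
proof (rule fn.subspaceI)
  show "0 \<in> (Esp s :: ('a \<Rightarrow> 'c) set)" by (simp add: Esp_def supported_def Eop_0 fun_eq_iff)
next
  fix x y :: "'a \<Rightarrow> 'c" assume "x \<in> Esp s" "y \<in> Esp s"
  then show "x + y \<in> Esp s"
    by (simp add: Esp_def supported_def Eop_add distrib_left) (simp add: fun_eq_iff)
next
  fix c and x :: "'a \<Rightarrow> 'c" assume "x \<in> Esp s"
  then show "(\<lambda>v. c * x v) \<in> Esp s"
    by (simp add: Esp_def supported_def Eop_scale mult.left_commute)
qed

lemma sum_\<sigma>_Aop: "(\<Sum>v\<in>V. \<sigma> v * Aop f v) = - of_nat k * (\<Sum>v\<in>V. \<sigma> v * f v)"
  for f :: "'a \<Rightarrow> 'c::comm_ring_1"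
  using sum_Aop[of "\<lambda>u. \<sigma> u * f u"] by (simp only: \<sigma>_Aop sum_negf mult_minus_left)

lemma sum_\<sigma>_Eop: "(\<Sum>v\<in>V. \<sigma> v * Eop f v) = (-1) ^ Suc d * (2 * (\<Sum>v\<in>V. \<sigma> v * f v))"
  for f :: "'a \<Rightarrow> 'c::comm_ring_1"
  using sum_Eop[of "\<lambda>u. \<sigma> u * f u"] by (simp only: \<sigma>_Eop sum_distrib_left[symmetric])

lemma Wsp_subspace: "fn.subspace (Wsp s :: ('a \<Rightarrow> 'c::field) set)"
proof (rule fn.subspaceI)
  show "0 \<in> (Wsp s :: ('a \<Rightarrow> 'c) set)"
    using fn.subspace_0[OF Esp_subspace] by (auto simp: Wsp_def)
next
  fix x y :: "'a \<Rightarrow> 'c" assume "x \<in> Wsp s" "y \<in> Wsp s"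
  then show "x + y \<in> Wsp s"
    using fn.subspace_add[OF Esp_subspace] by (auto simp: Wsp_def sum.distrib distrib_left)
next
  fix c and x :: "'a \<Rightarrow> 'c" assume "x \<in> Wsp s"
  moreover have "(\<Sum>v\<in>V. \<sigma> v * (c * x v)) = c * (\<Sum>v\<in>V. \<sigma> v * x v)"
    by (simp add: sum_distrib_left algebra_simps)
  ultimately show "(\<lambda>v. c * x v) \<in> Wsp s"
    using fn.subspace_scale[OF Esp_subspace, of x s c] by (auto simp: Wsp_def sum_distrib_left[symmetric])
qed

lemma poly_op_geo_Eop:
  fixes f :: "'a \<Rightarrow> 'c::linordered_field"
  assumes "f \<in> supported" "(\<Sum>v\<in>V. f v) = 0" "(\<Sum>v\<in>V. \<sigma> v * f v) = 0"
  shows "A.poly_op (geo (of_nat (k - 1)) (d - 1)) f = (\<lambda>v. - Eop f v)"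
proof -
  have "A.poly_op (geo (of_nat (k - 1)) (d - 1)) f = Sop (d - 1) f"
    using assms(1) d_ge by (intro poly_op_geo) (simp_all add: supported_def)
  moreover have "Sop (d - 1) f = (\<lambda>v. - Eop f v)"
    by (rule ext) (rule Sop_Eop[OF assms(2,3)])
  ultimately show ?thesis by (rule trans)
qed

text \<open>Under the sum conditions \<open>Eop\<close> is minus a polynomial in \<open>Aop\<close>,
  and \<open>Aop\<close> preserves these conditions, so the two operators commute there.\<close>

lemma Wsp_Aop:
  fixes f :: "'a \<Rightarrow> 'c::linordered_field"
  assumes f: "f \<in> Wsp s"
  shows "Aop f \<in> Wsp s"
proof -
  let ?p = "geo (of_nat (k - 1)) (d - 1) :: 'c poly"
  have f': "f \<in> supported" "(\<Sum>v\<in>V. f v) = 0" "(\<Sum>v\<in>V. \<sigma> v * f v) = 0" "Eop f = (\<lambda>v. s * f v)"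
    using f by (auto simp: Wsp_def Esp_def)
  have "Aop f \<in> supported" by (auto simp: supported_def Aop_def)
  then have Af: "Aop f \<in> supported" "(\<Sum>v\<in>V. Aop f v) = 0" "(\<Sum>v\<in>V. \<sigma> v * Aop f v) = 0"
    using f' by (auto simp: sum_Aop sum_\<sigma>_Aop)
  have "(\<lambda>v. - Eop (Aop f) v) = Aop (\<lambda>v. - Eop f v)"
    unfolding poly_op_geo_Eop[OF Af, symmetric] poly_op_geo_Eop[OF f'(1-3), symmetric]
    by (rule poly_op_Aop)
  also have "\<dots> = (\<lambda>v. - s * Aop f v)"
    using Aop_scale[of "- s" f] f'(4) by simp
  finally show ?thesis using Af by (auto simp: Wsp_def Esp_def fun_eq_iff)
qed

text \<open>On \<open>Wsp s\<close> the polynomial \<open>geo\<close> acts as \<open>- Eop\<close>,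
  hence as \<open>- s\<close>, and adding the constant \<open>s\<close> gives an annihilating
  polynomial.\<close>

lemma dvd_dim_Wsp:
  fixes s :: "'c::linordered_field"
  assumes "irreducible (geo (of_nat (k - 1)) (d - 1) + [:s:])"
  shows "d - 1 dvd fn.dim (Wsp s)"
proof -
  let ?p = "geo (of_nat (k - 1)) (d - 1) + [:s:] :: 'c poly"
  have "coeff ?p (d - 1) = 1"
    using d_ge by (cases "d - 1") (auto simp: coeff_geo_top[of _ "Suc _", simplified] coeff_geo_top)
  moreover have "degree ?p \<le> d - 1" using degree_geo by (intro degree_add_le) auto
  ultimately have "degree ?p = d - 1" by (metis le_antisym le_degree zero_neq_one)
  moreover have "degree ?p dvd fn.dim (Wsp s)"
  proof (rule A.irreducible_annihilator_degree_dvd_dim[OF assms Wsp_subspace Wsp_Aop])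
    show "finite (delta ` V :: ('a \<Rightarrow> 'c) set)" using finite_V by simp
    show "Wsp s \<subseteq> fn.span (delta ` V)" using supported_span by (auto simp: Wsp_def Esp_def)
    fix f :: "'a \<Rightarrow> 'c" assume f: "f \<in> Wsp s"
    then have "A.poly_op (geo (of_nat (k - 1)) (d - 1)) f = (\<lambda>v. - s * f v)"
      using poly_op_geo_Eop[of f] by (auto simp: Wsp_def Esp_def)
    moreover have "A.poly_op [:s:] f = (\<lambda>v. s * f v)" by (simp add: A.poly_op_pCons fun_eq_iff)
    ultimately show "A.poly_op ?p f = 0" by (simp add: A.poly_op_add fun_eq_iff)
  qed
  ultimately show ?thesis by simp
qed

text \<open>The energy \<open>\<Sum>(f u - e f v)\<^sup>2\<close> over antipodal pairs vanishes.\<close>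

lemma Esp_edge:
  fixes e :: "'c::linordered_field"
  assumes f: "f \<in> Esp (2 * e)" and e: "e * e = 1" and uv: "u \<in> V" "v \<in> V" "D u v = Suc d"
  shows "f u = e * f v"
proof -
  define R where "R u = {v \<in> V. D u v = Suc d}" for u
  have Ef: "(\<Sum>v\<in>R u. f v) = 2 * e * f u" if "u \<in> V" for u
    using f that by (auto simp: Esp_def Eop_def R_def fun_eq_iff split: if_splits)
  have fin: "finite (R u)" for u using finite_V by (auto simp: R_def)
  have sq: "(f u - e * f v)\<^sup>2 = (f u)\<^sup>2 - 2 * e * f u * f v + (f v)\<^sup>2" for u v
  proof -
    have "(f u - e * f v)\<^sup>2 = (f u)\<^sup>2 - 2 * e * f u * f v + (e * e) * (f v)\<^sup>2"
      by (simp add: power2_eq_square algebra_simps)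
    then show ?thesis by (simp add: e)
  qed
  \<comment> \<open>The parts of the expanded square contribute 2, 2 and -4 times the sum of all
    squares: the first two because every vertex has two antipodes, the mixed one by the eigenvalue
    equation and \<open>e * e = 1\<close>.\<close>
  have "(\<Sum>u\<in>V. \<Sum>v\<in>R u. (f v)\<^sup>2) = 2 * (\<Sum>u\<in>V. (f u)\<^sup>2)"
    using sum_Eop[of "\<lambda>v. (f v)\<^sup>2"] by (simp add: Eop_def R_def)
  moreover have "(\<Sum>u\<in>V. \<Sum>v\<in>R u. (f u)\<^sup>2) = 2 * (\<Sum>u\<in>V. (f u)\<^sup>2)"
    using card_antipodal by (simp add: R_def sum_distrib_left)
  moreover have "(\<Sum>u\<in>V. \<Sum>v\<in>R u. 2 * e * f u * f v) = 4 * (\<Sum>u\<in>V. (f u)\<^sup>2)"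
  proof -
    have "(\<Sum>v\<in>R u. 2 * e * f u * f v) = 4 * (f u)\<^sup>2" if "u \<in> V" for u
    proof -
      have "(\<Sum>v\<in>R u. 2 * e * f u * f v) = 4 * (e * e) * (f u)\<^sup>2"
        using Ef[OF that] by (simp add: sum_distrib_left[symmetric] power2_eq_square)
      then show ?thesis by (simp add: e)
    qed
    then show ?thesis by (simp add: sum_distrib_left)
  qed
  ultimately have "(\<Sum>u\<in>V. \<Sum>v\<in>R u. (f u - e * f v)\<^sup>2) = 0"
    by (simp add: sq sum.distrib sum_subtractf)
  then have "(\<Sum>v\<in>R u. (f u - e * f v)\<^sup>2) = 0"
    using uv finite_V by (subst (asm) sum_nonneg_eq_0_iff) (auto intro: sum_nonneg)
  then have "(f u - e * f v)\<^sup>2 = 0"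
    using uv fin by (subst (asm) sum_nonneg_eq_0_iff) (auto simp: R_def)
  then show ?thesis by simp
qed

lemma Esp_I:
  assumes "f \<in> supported" "\<And>u v. u \<in> V \<Longrightarrow> v \<in> V \<Longrightarrow> D u v = Suc d \<Longrightarrow> f v = e * f u"
  shows "f \<in> Esp (2 * e)"
proof -
  have "Eop f v = 2 * e * f v" for v
  proof (cases "v \<in> V")
    case True
    have "Eop f v = (\<Sum>u\<in>{u \<in> V. D v u = Suc d}. e * f v)"
      using assms(2) True by (auto simp: Eop_def intro!: sum.cong)
    then show ?thesis using card_antipodal[OF True] by simp
  qed (use assms(1) in \<open>auto simp: Eop_def supported_def\<close>)
  then have "Eop f = (\<lambda>v. 2 * e * f v)" by (rule ext)
  then show ?thesis using assms(1) by (simp add: Esp_def)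
qed

end

section \<open>Counting the components of the excess graph\<close>

text \<open>
  Follow a cycle by always leaving a vertex through the neighbour one did not come from; the
  parity of the step count is the colouring.
\<close>

lemma even_cycle_bicolourable:
  fixes S :: "'a set" and R :: "'a \<Rightarrow> 'a set"
  assumes fin: "finite S" and sub: "\<And>v. v \<in> S \<Longrightarrow> R v \<subseteq> S"
    and two: "\<And>v. v \<in> S \<Longrightarrow> card (R v) = 2" and irr: "\<And>v. v \<in> S \<Longrightarrow> v \<notin> R v"
    and sym: "\<And>u v. u \<in> S \<Longrightarrow> v \<in> R u \<Longrightarrow> u \<in> R v"
    and conn: "\<And>T. T \<subseteq> S \<Longrightarrow> T \<noteq> {} \<Longrightarrow> (\<And>v. v \<in> T \<Longrightarrow> R v \<subseteq> T) \<Longrightarrow> T = S"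
    and ev: "even (card S)"
  obtains c :: "'a \<Rightarrow> bool" where "\<And>u v. u \<in> S \<Longrightarrow> v \<in> R u \<Longrightarrow> c u \<noteq> c v"
proof (cases "S = {}")
  case True
  then show ?thesis using that by blast
next
  case False
  \<comment> \<open>The neighbour through which the walk leaves \<open>v\<close> after arriving from
    \<open>u\<close>.\<close>
  define oth where "oth v u = (THE w. w \<in> R v \<and> w \<noteq> u)" for v u
  have oth: "oth v u \<in> R v \<and> oth v u \<noteq> u \<and> R v = {u, oth v u}" if "v \<in> S" "u \<in> R v" for u v
  proof -
    obtain a b where "R v = {a, b}" "a \<noteq> b" using two[OF \<open>v \<in> S\<close>] by (auto simp: card_2_iff)
    then obtain w where w: "R v = {u, w}" "u \<noteq> w" using \<open>u \<in> R v\<close> by auto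
    then have "oth v u = w" unfolding oth_def by (intro the_equality) auto
    then show ?thesis using w by auto
  qed
  have oth_oth: "oth v (oth v u) = u" if "v \<in> S" "u \<in> R v" for u v
    using oth[OF that] oth[OF that(1), of "oth v u"] by auto
  obtain r where r: "r \<in> S" using False by blast
  obtain a where a: "a \<in> R r" using two[OF r] by (metis card.empty ex_in_conv zero_neq_numeral)
  \<comment> \<open>The walk is followed on directed edges instead of vertices: there the step is
    injective, so the orbit returns to its start.\<close>
  define Darts where "Darts = {(u, v). u \<in> S \<and> v \<in> R u}"
  define step where "step = (\<lambda>(u, v). (v, oth v u))"
  define p where "p n = (step ^^ n) (r, a)" for n
  define x where "x n = fst (p n)" for n
  have finD: "finite Darts"
    by (rule finite_subset[of _ "S \<times> S"]) (use sub fin in \<open>auto simp: Darts_def\<close>)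
  have stepD: "step e \<in> Darts" if "e \<in> Darts" for e
    using that sub sym oth by (force simp: Darts_def step_def)
  have step_inj: "e = e'" if e: "e \<in> Darts" "e' \<in> Darts" "step e = step e'" for e e'
  proof -
    obtain u v u' v' where uv: "e = (u, v)" "e' = (u', v')" by fastforce
    have "v = v'" "oth v u = oth v u'" using e(3) by (auto simp: uv step_def)
    moreover have "v \<in> S" "u \<in> R v" "u' \<in> R v"
      using e sub sym \<open>v = v'\<close> by (auto simp: uv Darts_def)
    ultimately show ?thesis using oth_oth uv by metis
  qed
  have pD: "p n \<in> Darts" for n
    by (induction n) (use r a stepD in \<open>auto simp: p_def Darts_def\<close>)
  have p_Suc: "p (Suc n) = step (p n)" for n by (simp add: p_def)
  have p_x: "p n = (x n, x (Suc n))" for n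
    by (simp add: x_def p_Suc step_def split: prod.split)
  have xS: "x n \<in> S" and xR: "x (Suc n) \<in> R (x n)" for n
    using pD[of n] by (auto simp: p_x Darts_def)
  have xR': "x n \<in> R (x (Suc n))" for n using sym xS xR by blast
  have x_SS: "x (Suc (Suc n)) = oth (x (Suc n)) (x n)" for n
    using p_Suc[of n] by (simp add: p_x step_def)
  have R_x: "R (x (Suc n)) = {x n, x (Suc (Suc n))}" for n
    using oth[OF xS xR'] by (simp add: x_SS)
  have x_neq2: "x (Suc (Suc n)) \<noteq> x n" for n
    using oth[OF xS xR'] by (simp add: x_SS)
  have x_neq1: "x (Suc n) \<noteq> x n" for n using irr xS xR by metis
  have p_cancel: "p i = p j \<Longrightarrow> i \<le> j \<Longrightarrow> p 0 = p (j - i)" for i j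
  proof (induction i arbitrary: j)
    case (Suc i)
    obtain j' where j': "j = Suc j'" "i \<le> j'" using Suc.prems(2) by (cases j) auto
    have "step (p i) = step (p j')" using Suc.prems(1) by (simp only: p_Suc j')
    then have "p i = p j'" by (rule step_inj[OF pD pD])
    then show ?case using Suc.IH[OF _ j'(2)] j'(1) by simp
  qed auto
  have "\<not> inj p"
    using finite_subset[OF _ finD, of "range p"] pD finite_imageD[of p UNIV] by auto
  then obtain i j where "p i = p j" "i < j" by (metis injI linorder_neqE_nat)
  then have ex: "0 < j - i \<and> p (j - i) = p 0" using p_cancel[of i j] by simp
  define m where "m = (LEAST l. 0 < l \<and> p l = p 0)"
  have m: "0 < m" "p m = p 0" and min: "\<And>l. l < m \<Longrightarrow> \<not> (0 < l \<and> p l = p 0)"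
    unfolding m_def
    using LeastI[of "\<lambda>l. 0 < l \<and> p l = p 0", OF ex] not_less_Least[of _ "\<lambda>l. 0 < l \<and> p l = p 0"]
    by blast+
  have p_add: "p (m + n) = p n" for n
    by (induction n) (use m in \<open>auto simp: p_Suc\<close>)
  have "x (m * l + n) = x n" for l n
    by (induction l) (use p_add in \<open>auto simp: x_def add.assoc\<close>)
  then have x_mod: "x n = x (n mod m)" for n by (metis mult_div_mod_eq)
  \<comment> \<open>If a vertex recurs within the least period \<open>m\<close>, either a directed
    edge recurs, against minimality, or the walk retraces its own steps. In the latter case it turns
    round halfway, so that \<open>x (n + 1) = x n\<close> or \<open>x (n + 2) = x n\<close> for some
    \<open>n\<close>.\<close>
  have inj_less: False if ij: "i < j" "j < m" "x i = x j" for i j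
  proof -
    obtain j' where j': "j = Suc j'" using ij by (cases j) auto
    have nb: "x (Suc i) \<in> R (x j)" using xR[of i] ij by simp
    show False
    proof (cases "x (Suc i) = x (Suc j)")
      case True
      then have "p i = p j" using ij by (simp add: p_x)
      then show False using p_cancel[of i j] min[OF less_imp_diff_less[OF ij(2), of i]] ij by simp
    next
      case False
      then have 1: "x (Suc i) = x j'" using nb R_x[of j'] j' by auto
      have refl: "t \<le> j' \<Longrightarrow> x (i + t) = x (j - t) \<and> x (Suc (i + t)) = x (j' - t)" for t
      proof (induction t)
        case (Suc t)
        then obtain l where l: "j' - t = Suc l" by (metis Suc_diff_Suc Suc_le_lessD)
        have IH: "x (i + t) = x (Suc (Suc l))" "x (Suc (i + t)) = x (Suc l)"
          using Suc l j' by (auto simp: Suc_diff_le)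
        have "x (Suc (Suc (i + t))) = oth (x (Suc l)) (x (Suc (Suc l)))"
          using x_SS[of "i + t"] IH by simp
        also have "\<dots> = x l" using oth_oth[OF xS xR'] by (simp add: x_SS)
        also have "l = j' - Suc t" using l by simp
        finally show ?case using IH l j' by simp
      qed (use ij j' 1 in simp)
      show False
      proof (cases "even (j - i)")
        case True
        then obtain h where h: "j - i = 2 * h" by (rule evenE)
        then obtain h' where "h = Suc h'" using ij by (cases h) auto
        then have "j = Suc (Suc (i + h')) + h'" using h ij by simp
        then show False using refl[of h'] x_neq2[of "i + h'"] j' by simp
      next
        case False
        then obtain h where "j - i = 2 * h + 1" by (rule oddE)
        then have "j = Suc (i + h) + h" using ij by simp
        then show False using refl[of h] x_neq1[of "i + h"] j' by simp
      qed
    qed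
  qed
  have inj: "inj_on x {..<m}"
    by (rule inj_onI) (metis inj_less lessThan_iff linorder_neqE_nat)
  have "range x = S"
  proof (rule conn)
    fix v assume "v \<in> range x"
    then obtain n where "v = x n" by blast
    \<comment> \<open>Adding the period gives the index a predecessor even for
      \<open>n = 0\<close>.\<close>
    then have "v = x (Suc (n + m - 1))" using p_add[of n] m(1) by (simp add: x_def add.commute)
    then show "R v \<subseteq> range x" using R_x by auto
  qed (use xS in auto)
  moreover have "range x = x ` {..<m}"
  proof
    show "range x \<subseteq> x ` {..<m}"
    proof
      fix v assume "v \<in> range x"
      then obtain n where "v = x (n mod m)" using x_mod by auto
      then show "v \<in> x ` {..<m}" using m(1) by simp
    qed
  qed auto
  ultimately have im: "x ` {..<m} = S" by simp
  then have "even m" using ev card_image[OF inj] by simp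
  \<comment> \<open>As the period is even, the parity of an index depends only on the
    vertex.\<close>
  have par: "even n = even n'" if "x n = x n'" for n n'
  proof -
    have "n mod m = n' mod m"
      using that inj_onD[OF inj, of "n mod m" "n' mod m"] x_mod[of n] x_mod[of n'] m(1) by simp
    then show ?thesis using \<open>even m\<close> by (metis dvd_mod_iff)
  qed
  show ?thesis
  proof (rule that[of "\<lambda>v. \<exists>n. x n = v \<and> even n"])
    fix u v assume uv: "u \<in> S" "v \<in> R u"
    have c: "(\<exists>n'. x n' = x n \<and> even n') = even n" for n using par by blast
    obtain n where "u = x n" using uv im by auto
    then have u: "u = x (Suc (n + m - 1))" using p_add[of n] m(1) by (simp add: x_def add.commute)
    then consider "v = x (n + m - 1)" | "v = x (Suc (Suc (n + m - 1)))" using uv R_x by auto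
    then show "(\<exists>n. x n = u \<and> even n) \<noteq> (\<exists>n. x n = v \<and> even n)"
      by cases (simp_all only: u c even_Suc, simp_all)
  qed
qed

text \<open>\<open>P\<close> stands for the vertex sets of the components of the excess graph.
  \<open>conn_P\<close> is connectedness as an induction principle: a property spreads over a
  component once the set of vertices having it is closed under antipodes.\<close>

locale antipodal_components = moore_distance +
  fixes P :: "'a set set"
  assumes Union_P: "\<Union>P = V"
    and disjoint_P: "S \<in> P \<Longrightarrow> S' \<in> P \<Longrightarrow> v \<in> S \<Longrightarrow> v \<in> S' \<Longrightarrow> S = S'"
    and ne_P: "S \<in> P \<Longrightarrow> S \<noteq> {}"
    and closed_P: "S \<in> P \<Longrightarrow> u \<in> S \<Longrightarrow> v \<in> V \<Longrightarrow> D u v = Suc d \<Longrightarrow> v \<in> S"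
    and conn_P: "S \<in> P \<Longrightarrow> T \<subseteq> S \<Longrightarrow> T \<noteq> {} \<Longrightarrow>
      (\<And>u v. u \<in> T \<Longrightarrow> v \<in> V \<Longrightarrow> D u v = Suc d \<Longrightarrow> v \<in> T) \<Longrightarrow> T = S"
begin

lemma P_subset: "S \<in> P \<Longrightarrow> S \<subseteq> V"
  using Union_P by blast

lemma finite_P: "finite P"
  using Union_P finite_V finite_UnionD by blast

text \<open>By \<open>Esp_edge\<close> an eigenfunction is determined on a component by one value,
  so on \<open>S\<close> it is a multiple of \<open>g S\<close>. The set \<open>Q\<close> will be
  \<open>P\<close> for \<open>e = 1\<close> and the components of even size for
  \<open>e = - 1\<close>.\<close>

lemma dim_Esp:
  fixes e :: "'c::linordered_field"
  assumes e: "e * e = 1" and Q: "Q \<subseteq> P" and g0: "\<And>S v. S \<in> Q \<Longrightarrow> g S v \<noteq> 0 \<longleftrightarrow> v \<in> S"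
    and g_edge: "\<And>S u v. S \<in> Q \<Longrightarrow> u \<in> V \<Longrightarrow> v \<in> V \<Longrightarrow> D u v = Suc d \<Longrightarrow> g S v = e * g S u"
    and van: "\<And>f S v. f \<in> Esp (2 * e) \<Longrightarrow> S \<in> P - Q \<Longrightarrow> v \<in> S \<Longrightarrow> f v = 0"
  shows "fn.dim (Esp (2 * e)) = card Q"
proof -
  have finQ: "finite Q" using Q finite_P finite_subset by blast
  obtain r where r: "\<And>S. S \<in> P \<Longrightarrow> r S \<in> S" using ne_P by (metis all_not_in_conv)
  have g_r: "g S (r S') = 0" if "S \<in> Q" "S' \<in> Q" "S \<noteq> S'" for S S'
    using g0[OF that(1)] that disjoint_P[of S S' "r S'"] r Q by blast
  have g_rr: "g S (r S) \<noteq> 0" if "S \<in> Q" for S using g0[OF that] r Q that by blast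
  have inj: "inj_on g Q" by (rule inj_onI) (metis g_r g_rr)
  have in_Esp: "g ` Q \<subseteq> Esp (2 * e)"
  proof
    fix f assume "f \<in> g ` Q"
    then obtain S where S: "S \<in> Q" "f = g S" by blast
    have "f \<in> supported" using g0[OF S(1)] P_subset Q S by (auto simp: supported_def)
    then show "f \<in> Esp (2 * e)" using g_edge[OF S(1)] by (intro Esp_I) (simp_all add: S)
  qed
  have "Esp (2 * e) \<subseteq> fn.span (g ` Q)"
  proof
    fix f assume f: "f \<in> Esp (2 * e)"
    have ratio: "f v * g S (r S) = f (r S) * g S v" if S: "S \<in> Q" and v: "v \<in> S" for S v
    proof -
      have SP: "S \<in> P" using S Q by blast
      \<comment> \<open>Proportionality passes from a vertex to its antipodes because both functions
        are multiplied by \<open>e\<close>.\<close>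
      have "{v \<in> S. f v * g S (r S) = f (r S) * g S v} = S"
      proof (rule conn_P[OF SP])
        show "{v \<in> S. f v * g S (r S) = f (r S) * g S v} \<noteq> {}" using r[OF SP] by auto
        fix u v assume u: "u \<in> {v \<in> S. f v * g S (r S) = f (r S) * g S v}"
          and v: "v \<in> V" "D u v = Suc d"
        have uV: "u \<in> V" using u P_subset[OF SP] by blast
        have "f v = e * f u" using Esp_edge[OF f e v(1) uV] v D_sym[OF v(1) uV] by simp
        then have "f v * g S (r S) = e * (f u * g S (r S))" by simp
        also have "\<dots> = f (r S) * (e * g S u)" using u by simp
        also have "\<dots> = f (r S) * g S v" using g_edge[OF S uV v] by simp
        finally show "v \<in> {v \<in> S. f v * g S (r S) = f (r S) * g S v}"
          using closed_P[OF SP _ v] u by simp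
      qed auto
      then show ?thesis using v by blast
    qed
    have "f = (\<Sum>S\<in>Q. (\<lambda>v. (f (r S) / g S (r S)) * g S v))"
    proof
      fix v
      have "f v = (\<Sum>S\<in>Q. (f (r S) / g S (r S)) * g S v)"
      proof (cases "\<exists>S\<in>Q. v \<in> S")
        case True
        then obtain S where S: "S \<in> Q" "v \<in> S" by blast
        have "(\<Sum>S'\<in>Q - {S}. (f (r S') / g S' (r S')) * g S' v) = 0"
          using g0 disjoint_P S Q by (intro sum.neutral) fastforce
        then have "(\<Sum>S'\<in>Q. (f (r S') / g S' (r S')) * g S' v) = (f (r S) / g S (r S)) * g S v"
          using finQ S by (simp add: sum.remove)
        also have "\<dots> = f v" using ratio[OF S] g_rr[OF S(1)] by (simp add: field_simps)
        finally show ?thesis by simp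
      next
        case False
        then have "f v = 0"
          using van[OF f] f Union_P by (cases "v \<in> V") (auto simp: Esp_def supported_def)
        moreover have "(\<Sum>S\<in>Q. (f (r S) / g S (r S)) * g S v) = 0"
          using False g0 by (intro sum.neutral) auto
        ultimately show ?thesis by simp
      qed
      then show "f v = (\<Sum>S\<in>Q. (\<lambda>v. (f (r S) / g S (r S)) * g S v)) v" by (simp add: sum_fun_apply)
    qed
    also have "\<dots> \<in> fn.span (g ` Q)"
      by (intro fn.span_sum fn.span_scale fn.span_base) auto
    finally show "f \<in> fn.span (g ` Q)" .
  qed
  moreover have "fn.independent (g ` Q)"
  proof
    assume "fn.dependent (g ` Q)"
    then obtain a b where a: "b \<in> g ` Q" "a b \<noteq> 0" "(\<Sum>h\<in>g ` Q. (\<lambda>v. a h * h v)) = 0"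
      using fn.dependent_finite[of "g ` Q"] finQ by blast
    then obtain S where S: "S \<in> Q" "b = g S" by blast
    have "0 = (\<Sum>S'\<in>Q. a (g S') * g S' (r S))"
      using fun_cong[OF a(3), of "r S"] by (simp add: sum_fun_apply sum.reindex[OF inj])
    also have "\<dots> = a (g S) * g S (r S)"
      using finQ S g_r by (simp add: sum.remove)
    finally show False using a(2) S g_rr by simp
  qed
  ultimately show ?thesis
    using fn.dim_unique[OF in_Esp] card_image[OF inj] by blast
qed

lemma dim_Esp_2: "fn.dim (Esp (2 :: 'c::linordered_field)) = card P"
proof -
  have "fn.dim (Esp (2 * 1 :: 'c)) = card P"
  proof (rule dim_Esp)
    fix S u v assume "S \<in> P" "u \<in> V" "v \<in> V" "D u v = Suc d"
    then show "(if v \<in> S then 1 else 0) = 1 * (if u \<in> S then 1 else 0 :: 'c)"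
      using closed_P[of S u v] closed_P[of S v u] D_sym[of u v] by auto
  qed auto
  then show ?thesis by simp
qed

text \<open>On \<open>S\<close> the function takes only a value and its negative. Cut off outside
  \<open>S\<close> it remains an eigenfunction, so \<open>Eop\<close> multiplies its total both by 2
  and by -2. The total is therefore 0, both values occur equally often, and \<open>card S\<close>
  would be even.\<close>

lemma odd_component_vanish:
  fixes f :: "'a \<Rightarrow> 'c::linordered_field"
  assumes f: "f \<in> Esp (-2)" and S: "S \<in> P" "odd (card S)" and v: "v \<in> S"
  shows "f v = 0"
proof (rule ccontr)
  assume nz: "f v \<noteq> 0"
  have SV: "S \<subseteq> V" using P_subset S by blast
  then have finS: "finite S" using finite_V finite_subset by blast
  have edge: "f w = - f u" if "u \<in> S" "w \<in> V" "D u w = Suc d" for u w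
    using Esp_edge[of f "-1" w u] f that SV D_sym by auto
  have "{u \<in> S. f u = f v \<or> f u = - f v} = S"
    by (rule conn_P[OF S(1)]) (use v edge closed_P[OF S(1)] in auto)
  then have vals: "f u = f v \<or> f u = - f v" if "u \<in> S" for u using that by blast
  let ?g = "\<lambda>u. if u \<in> S then f u else 0"
  have "Eop ?g u = - 2 * ?g u" if "u \<in> V" for u
  proof (cases "u \<in> S")
    case True
    have "Eop ?g u = (\<Sum>w\<in>{w \<in> V. D u w = Suc d}. - f u)"
      using that edge[OF True] closed_P[OF S(1) True] by (auto simp: Eop_def intro!: sum.cong)
    then show ?thesis using card_antipodal[OF that] True by simp
  next
    case False
    then have "w \<notin> S" if "w \<in> V" "D u w = Suc d" for w
      using closed_P[OF S(1), of w u] that \<open>u \<in> V\<close> D_sym by auto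
    then show ?thesis using False that by (auto simp: Eop_def intro!: sum.neutral)
  qed
  then have "- 2 * (\<Sum>u\<in>V. ?g u) = 2 * (\<Sum>u\<in>V. ?g u)"
    unfolding sum_Eop[symmetric] by (simp add: sum_distrib_left sum_negf)
  then have "(\<Sum>u\<in>V. ?g u) = 0" by simp
  then have "(\<Sum>u\<in>S. f u) = 0"
    using finite_V SV by (simp add: sum.inter_restrict[symmetric] Int_absorb1)
  moreover have "S = {u \<in> S. f u = f v} \<union> {u \<in> S. f u = - f v}" using vals by blast
  moreover have "{u \<in> S. f u = f v} \<inter> {u \<in> S. f u = - f v} = {}" using nz by auto
  ultimately have "(\<Sum>u\<in>{u \<in> S. f u = f v}. f u) + (\<Sum>u\<in>{u \<in> S. f u = - f v}. f u) = 0"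
    and cS: "card S = card {u \<in> S. f u = f v} + card {u \<in> S. f u = - f v}"
    using finS by (metis (no_types, lifting) finite_Un sum.union_disjoint,
      metis (no_types, lifting) finite_Un card_Un_disjoint)
  then have "of_nat (card {u \<in> S. f u = f v}) * f v = of_nat (card {u \<in> S. f u = - f v}) * f v"
    by simp
  then have "card {u \<in> S. f u = f v} = card {u \<in> S. f u = - f v}" using nz by simp
  then show False using cS S(2) by simp
qed

text \<open>The 2-colouring of an even cycle, read as signs, is the eigenfunction that
  \<open>dim_Esp\<close> asks for.\<close>

lemma dim_Esp_neg_2: "fn.dim (Esp (- 2 :: 'c::linordered_field)) = card {S \<in> P. even (card S)}"
proof -
  let ?Q = "{S \<in> P. even (card S)}"
  have "\<exists>c :: 'a \<Rightarrow> bool. \<forall>u v. u \<in> S \<longrightarrow> v \<in> V \<and> D u v = Suc d \<longrightarrow> c u \<noteq> c v" if S: "S \<in> ?Q" for S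
  proof -
    have SP: "S \<in> P" and SV: "S \<subseteq> V" using S P_subset by auto
    show ?thesis
    proof (rule even_cycle_bicolourable[of S "\<lambda>u. {v \<in> V. D u v = Suc d}"])
      show "finite S" using SV finite_V finite_subset by blast
      show "even (card S)" using S by simp
      show "\<And>T. T \<subseteq> S \<Longrightarrow> T \<noteq> {} \<Longrightarrow> (\<And>v. v \<in> T \<Longrightarrow> {u \<in> V. D v u = Suc d} \<subseteq> T) \<Longrightarrow> T = S"
        using conn_P[OF SP] by blast
    next
      fix u assume u: "u \<in> S"
      then have uV: "u \<in> V" using SV by blast
      show "{v \<in> V. D u v = Suc d} \<subseteq> S" using closed_P[OF SP u] by blast
      show "card {v \<in> V. D u v = Suc d} = 2" using card_antipodal[OF uV] .
      show "u \<notin> {v \<in> V. D u v = Suc d}" using uV by simp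
      show "u \<in> {w \<in> V. D v w = Suc d}" if "v \<in> {v \<in> V. D u v = Suc d}" for v
        using that uV D_sym[OF uV, of v] by simp
    next
      fix c :: "'a \<Rightarrow> bool"
      assume "\<And>u v. u \<in> S \<Longrightarrow> v \<in> {v \<in> V. D u v = Suc d} \<Longrightarrow> c u \<noteq> c v"
      then show ?thesis by blast
    qed
  qed
  then obtain c :: "'a set \<Rightarrow> 'a \<Rightarrow> bool" where
    c: "\<And>S u v. S \<in> ?Q \<Longrightarrow> u \<in> S \<Longrightarrow> v \<in> V \<Longrightarrow> D u v = Suc d \<Longrightarrow> c S u \<noteq> c S v"
    by metis
  have "fn.dim (Esp (2 * - 1 :: 'c)) = card ?Q"
  proof (rule dim_Esp[where g = "\<lambda>S v. if v \<in> S then if c S v then 1 else - 1 else 0"])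
    fix S u v assume *: "S \<in> ?Q" "u \<in> V" "v \<in> V" "D u v = Suc d"
    have iff: "u \<in> S \<longleftrightarrow> v \<in> S"
      using closed_P[of S u v] closed_P[of S v u] * D_sym[of u v] by auto
    show "(if v \<in> S then if c S v then 1 else - 1 else 0)
      = - 1 * (if u \<in> S then if c S u then 1 else - 1 else (0 :: 'c))"
      using c[OF *(1) _ *(3,4)] iff by auto
  next
    fix f :: "'a \<Rightarrow> 'c" and S v assume "f \<in> Esp (2 * - 1)" "S \<in> P - ?Q" "v \<in> S"
    then show "f v = 0" using odd_component_vanish[of f S v] by simp
  qed (auto split: if_splits)
  then show ?thesis by simp
qed

section \<open>The cost of the sum conditions\<close>

lemma one_Esp: "(\<lambda>v. if v \<in> V then 1 else 0) \<in> (Esp 2 :: ('a \<Rightarrow> 'c::comm_ring_1) set)"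
  using Esp_I[of "\<lambda>v. if v \<in> V then 1 else 0" "1 :: 'c"] by (simp add: supported_def)

lemma \<sigma>_Esp:
  "(\<lambda>v. if v \<in> V then \<sigma> v else 0) \<in> (Esp (2 * (-1) ^ Suc d) :: ('a \<Rightarrow> 'c::comm_ring_1) set)"
proof (rule Esp_I)
  fix u v assume uv: "u \<in> V" "v \<in> V" "D u v = Suc d"
  have "\<sigma> v = (\<sigma> u * \<sigma> v) * (\<sigma> u :: 'c)" by (metis \<sigma>_square mult.assoc mult.commute mult_1)
  also have "\<dots> = (-1) ^ Suc d * \<sigma> u" by (simp only: \<sigma>_mult[OF uv(1,2)] uv(3))
  finally show "(if v \<in> V then \<sigma> v else 0) = (-1) ^ Suc d * (if u \<in> V then \<sigma> u else (0 :: 'c))"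
    using uv by simp
qed (simp add: supported_def)

text \<open>The halves are equally large: the total of \<open>Aop \<sigma>\<close> is
  \<open>k\<close> times the sum by regularity, and \<open>- k\<close> times it because edges join
  different halves.\<close>

lemma sum_\<sigma>: "(\<Sum>v\<in>V. \<sigma> v) = (0 :: 'c::linordered_field)"
proof -
  have "of_nat k * (\<Sum>v\<in>V. \<sigma> v) = (\<Sum>v\<in>V. Aop \<sigma> v :: 'c)" by (simp add: sum_Aop)
  also have "\<dots> = - (\<Sum>v\<in>V. \<sigma> v * Aop (\<lambda>_. 1) v)" by (simp add: \<sigma>_Aop sum_negf)
  also have "\<dots> = - (\<Sum>v\<in>V. \<sigma> v * of_nat k)"
    using card_N by (intro arg_cong[of _ _ uminus] sum.cong) (auto simp: Aop_def)
  also have "\<dots> = - (of_nat k * (\<Sum>v\<in>V. \<sigma> v))"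
    by (simp add: sum_distrib_left mult.commute)
  finally have "of_nat k * (\<Sum>v\<in>V. \<sigma> v) = (0 :: 'c)" by simp
  then show ?thesis using k_ge by simp
qed

text \<open>The eigenvalue equation is summed over \<open>V\<close>, plainly and with signs. Over an
  ordered field the first sum can be nonzero only for \<open>s = 2\<close>, the second only for
  \<open>s = 2 * (-1) ^ Suc d\<close>.\<close>

lemma Esp_sums:
  fixes f :: "'a \<Rightarrow> 'c::comm_ring_1"
  assumes "f \<in> Esp s"
  shows "s * (\<Sum>v\<in>V. f v) = 2 * (\<Sum>v\<in>V. f v)"
    and "s * (\<Sum>v\<in>V. \<sigma> v * f v) = (-1) ^ Suc d * (2 * (\<Sum>v\<in>V. \<sigma> v * f v))"
proof -
  have "Eop f = (\<lambda>v. s * f v)" using assms by (simp add: Esp_def)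
  then have "(\<Sum>v\<in>V. Eop f v) = s * (\<Sum>v\<in>V. f v)"
    "(\<Sum>v\<in>V. \<sigma> v * Eop f v) = s * (\<Sum>v\<in>V. \<sigma> v * f v)"
    by (simp_all add: sum_distrib_left mult.left_commute)
  then show "s * (\<Sum>v\<in>V. f v) = 2 * (\<Sum>v\<in>V. f v)"
    "s * (\<Sum>v\<in>V. \<sigma> v * f v) = (-1) ^ Suc d * (2 * (\<Sum>v\<in>V. \<sigma> v * f v))"
    using sum_Eop[of f] sum_\<sigma>_Eop[of f] by (simp_all only:)
qed

lemma dim_sum_zero:
  fixes X :: "('a \<Rightarrow> 'c::linordered_field) set"
  assumes "fn.subspace X" "X \<subseteq> supported" "b \<in> X" "(\<Sum>v\<in>V. h v * b v) \<noteq> 0"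
  shows "fn.dim X = Suc (fn.dim {f \<in> X. (\<Sum>v\<in>V. h v * f v) = 0})"
proof (rule fn.dim_kernel_functional[where \<phi> = "\<lambda>f. \<Sum>v\<in>V. h v * f v" and b = b and S = "delta ` V"])
  show "finite (delta ` V :: ('a \<Rightarrow> 'c) set)" using finite_V by simp
  show "X \<subseteq> fn.span (delta ` V)" using supported_span assms(2) by blast
  fix x y :: "'a \<Rightarrow> 'c" and c :: 'c
  show "(\<Sum>v\<in>V. h v * (x + y) v) = (\<Sum>v\<in>V. h v * x v) + (\<Sum>v\<in>V. h v * y v)"
    by (simp add: sum.distrib distrib_left)
  show "(\<Sum>v\<in>V. h v * (c * x v)) = c * (\<Sum>v\<in>V. h v * x v)"
    by (simp add: sum_distrib_left mult.left_commute)
qed (use assms in simp_all)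

lemma card_V_nonzero: "(of_nat (card V) :: 'c::linordered_field) \<noteq> 0"
  using finite_V V_ne by simp

text \<open>A sum condition costs one dimension if its test function lies in the eigenspace, and
  holds automatically otherwise. The constant 1 belongs to the eigenvalue 2, and
  \<open>\<sigma>\<close> to 2 or -2 according as \<open>d\<close> is odd or even.\<close>

lemma dim_Wsp:
  shows "odd d \<Longrightarrow> fn.dim (Esp 2 :: ('a \<Rightarrow> 'c::linordered_field) set) = fn.dim (Wsp 2 :: ('a \<Rightarrow> 'c) set) + 2"
    and "odd d \<Longrightarrow> fn.dim (Esp (-2) :: ('a \<Rightarrow> 'c) set) = fn.dim (Wsp (-2) :: ('a \<Rightarrow> 'c) set)"
    and "even d \<Longrightarrow> fn.dim (Esp 2 :: ('a \<Rightarrow> 'c) set) = fn.dim (Wsp 2 :: ('a \<Rightarrow> 'c) set) + 1"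
    and "even d \<Longrightarrow> fn.dim (Esp (-2) :: ('a \<Rightarrow> 'c) set) = fn.dim (Wsp (-2) :: ('a \<Rightarrow> 'c) set) + 1"
proof -
  let ?one = "\<lambda>v. if v \<in> V then 1 else 0 :: 'c" and ?\<sigma> = "\<lambda>v. if v \<in> V then \<sigma> v else 0 :: 'c"
  have sup: "Esp s \<subseteq> supported" for s :: 'c by (auto simp: Esp_def)
  have one1: "(\<Sum>v\<in>V. 1 * ?one v) \<noteq> 0" using card_V_nonzero by simp
  have \<sigma>\<sigma>: "(\<Sum>v\<in>V. \<sigma> v * ?\<sigma> v) \<noteq> 0" using card_V_nonzero by simp
  have \<sigma>1: "(\<Sum>v\<in>V. 1 * ?\<sigma> v) = 0" using sum_\<sigma> by simp
  define K where "K = {f \<in> Esp (2 :: 'c). (\<Sum>v\<in>V. 1 * f v) = 0}"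
  have dimK: "fn.dim (Esp (2 :: 'c)) = Suc (fn.dim K)"
    unfolding K_def by (rule dim_sum_zero[OF Esp_subspace sup one_Esp one1])
  have subK: "fn.subspace K"
    unfolding K_def using Esp_subspace[of 2]
    by (auto simp: fn.subspace_def sum.distrib sum_distrib_left[symmetric])
  {
    assume "odd d"
    \<comment> \<open>\<open>\<sigma>\<close> has sum zero, so it survives in \<open>K\<close> and
      shows that the second condition costs a further dimension.\<close>
    then have \<sigma>K: "?\<sigma> \<in> K" using \<sigma>_Esp \<sigma>1 by (simp add: K_def)
    have "fn.dim K = Suc (fn.dim {f \<in> K. (\<Sum>v\<in>V. \<sigma> v * f v) = 0})"
      by (rule dim_sum_zero[OF subK _ \<sigma>K \<sigma>\<sigma>]) (use sup in \<open>auto simp: K_def\<close>)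
    moreover have "{f \<in> K. (\<Sum>v\<in>V. \<sigma> v * f v) = 0} = Wsp 2" by (auto simp: K_def Wsp_def)
    ultimately show "fn.dim (Esp (2 :: 'c)) = fn.dim (Wsp (2 :: 'c)) + 2" using dimK by simp
    have "Esp (-2 :: 'c) \<subseteq> Wsp (-2)"
    proof
      fix f assume f: "f \<in> Esp (-2 :: 'c)"
      then show "f \<in> Wsp (-2)" using Esp_sums[OF f] \<open>odd d\<close> by (simp add: Wsp_def)
    qed
    then have "Wsp (-2) = Esp (-2 :: 'c)" by (auto simp: Wsp_def)
    then show "fn.dim (Esp (- 2 :: 'c)) = fn.dim (Wsp (- 2 :: 'c))" by simp
  }
  {
    assume d: "even d"
    have "K \<subseteq> Wsp 2"
    proof
      fix f assume f: "f \<in> K"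
      then show "f \<in> Wsp 2" using Esp_sums(2)[of f 2] d by (simp add: Wsp_def K_def)
    qed
    then have "K = Wsp 2" by (auto simp: Wsp_def K_def)
    then show "fn.dim (Esp (2 :: 'c)) = fn.dim (Wsp (2 :: 'c)) + 1" using dimK by simp
    have \<sigma>E: "?\<sigma> \<in> Esp (-2)" using \<sigma>_Esp[where 'c='c] d by simp
    have "fn.dim (Esp (-2 :: 'c)) = Suc (fn.dim {f \<in> Esp (-2 :: 'c). (\<Sum>v\<in>V. \<sigma> v * f v) = 0})"
      by (rule dim_sum_zero[OF Esp_subspace sup \<sigma>E \<sigma>\<sigma>])
    moreover have "{f \<in> Esp (-2 :: 'c). (\<Sum>v\<in>V. \<sigma> v * f v) = 0} = Wsp (-2)"
    proof (intro equalityI subsetI)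
      fix f assume f: "f \<in> {f \<in> Esp (-2 :: 'c). (\<Sum>v\<in>V. \<sigma> v * f v) = 0}"
      then show "f \<in> Wsp (-2)" using Esp_sums(1)[of f "-2"] by (simp add: Wsp_def)
    qed (auto simp: Wsp_def)
    ultimately show "fn.dim (Esp (-2 :: 'c)) = fn.dim (Wsp (-2 :: 'c)) + 1" by simp
  }
qed

lemma to_fract_of_nat: "to_fract (of_nat n) = of_nat n"
  by (induction n) auto

text \<open>The type \<open>int fract\<close> serves as the rationals: Gauss's lemma is available for it.\<close>

lemma component_count_dvd:
  assumes "odd k" "4 \<le> d"
  defines "c \<equiv> card P" and "c2 \<equiv> card {S \<in> P. even (card S)}"
  shows "odd d \<Longrightarrow> (int d - 1) dvd (int c - 2) \<and> (int d - 1) dvd int c2"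
    and "even d \<Longrightarrow> (int d - 1) dvd (int c - 1) \<and> (int d - 1) dvd (int c2 - 1)"
proof -
  have irr: "irreducible (geo (of_nat (k - 1)) (d - 1) + [:to_fract s:])" if "s = 2 \<or> s = -2" for s :: int
  proof -
    \<comment> \<open>Here \<open>k - 1\<close> is even, \<open>d - 1 \<ge> 3\<close>, and neither 2
      nor -2 is divisible by 4.\<close>
    have "irreducible (geo (to_fract (of_nat (k - 1))) (d - 1) + [:to_fract s:])"
      using assms(1,2) that by (intro irreducible_geo) auto
    then show ?thesis by (simp only: to_fract_of_nat)
  qed
  have two: "to_fract (2 :: int) = 2" using to_fract_of_nat[of 2] by simp
  have "d - 1 dvd fn.dim (Wsp (2 :: int fract))"
    using dvd_dim_Wsp[OF irr[of 2]] two by simp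
  moreover have "d - 1 dvd fn.dim (Wsp (- 2 :: int fract))"
    using dvd_dim_Wsp[OF irr[of "-2"]] two by simp
  moreover have "int (d - 1) = int d - 1" using assms(2) by simp
  ultimately have dvd: "(int d - 1) dvd int (fn.dim (Wsp (2 :: int fract)))"
    "(int d - 1) dvd int (fn.dim (Wsp (- 2 :: int fract)))"
    by (metis int_dvd_int_iff)+
  note dims = dim_Wsp[where 'c = "int fract", unfolded dim_Esp_2 dim_Esp_neg_2, folded c_def c2_def]
  show "odd d \<Longrightarrow> (int d - 1) dvd (int c - 2) \<and> (int d - 1) dvd int c2"
    "even d \<Longrightarrow> (int d - 1) dvd (int c - 1) \<and> (int d - 1) dvd (int c2 - 1)"
    using dims dvd by simp_all
qed

end

section \<open>From graphs to distances\<close>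

text \<open>Only inner turns of the closed walk are restricted, not the turn at its base point. Thus
  two geodesics with a common initial stretch may be joined.\<close>

locale locally_tree_like =
  fixes E :: "('a \<times> 'a) set" and d :: nat
  assumes E_sym: "(u, v) \<in> E \<Longrightarrow> (v, u) \<in> E"
    and closed_walk: "\<And>f n. 0 < n \<Longrightarrow> f 0 = f n \<Longrightarrow> (\<And>i. i < n \<Longrightarrow> (f i, f (Suc i)) \<in> E)
      \<Longrightarrow> (\<And>i. Suc (Suc i) \<le> n \<Longrightarrow> f i \<noteq> f (Suc (Suc i))) \<Longrightarrow> 2 * d \<le> n"
begin

text \<open>Unreachable vertices get the junk distance \<open>d + 2\<close>, so every distance up to \<open>d + 1\<close> is genuine.\<close>

definition gdist :: "'a \<Rightarrow> 'a \<Rightarrow> nat" where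
  "gdist u v = (if \<exists>n. (u, v) \<in> E ^^ n then LEAST n. (u, v) \<in> E ^^ n else d + 2)"

lemma relpow_E_sym: "(u, v) \<in> E ^^ n \<Longrightarrow> (v, u) \<in> E ^^ n"
proof (induction n arbitrary: v)
  case (Suc n)
  then obtain w where "(u, w) \<in> E ^^ n" "(w, v) \<in> E" by auto
  then show ?case using Suc.IH E_sym relpow_Suc_I2 by metis
qed auto

lemma gdist_sym: "gdist u v = gdist v u"
proof -
  have "(u, v) \<in> E ^^ n \<longleftrightarrow> (v, u) \<in> E ^^ n" for n using relpow_E_sym by blast
  then show ?thesis by (simp add: gdist_def)
qed

lemma gdist_le: "(u, v) \<in> E ^^ n \<Longrightarrow> gdist u v \<le> n"
  by (auto simp: gdist_def intro: Least_le)

lemma gdist_walk: "gdist u v \<le> Suc d \<Longrightarrow> (u, v) \<in> E ^^ gdist u v"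
  by (auto simp: gdist_def intro: LeastI split: if_splits)

lemma gdist_step:
  assumes "(v, w) \<in> E"
  shows "gdist u w \<le> Suc (gdist u v)"
proof (cases "\<exists>n. (u, v) \<in> E ^^ n")
  case True
  then have "(u, v) \<in> E ^^ gdist u v" by (auto simp: gdist_def intro: LeastI)
  then show ?thesis using assms by (intro gdist_le) auto
next
  case False
  moreover have "\<not> (\<exists>n. (u, w) \<in> E ^^ n)"
    using False relpow_Suc_I[OF _ E_sym[OF assms]] by blast
  ultimately show ?thesis by (simp add: gdist_def)
qed

lemma gdist_eq_0: "gdist u v = 0 \<longleftrightarrow> u = v"
  using gdist_walk[of u v] gdist_le[of u v 0] by auto

lemma gdist_pred:
  assumes "0 < gdist u v" "gdist u v \<le> Suc d"
  shows "\<exists>w. (v, w) \<in> E \<and> gdist u w < gdist u v"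
proof -
  obtain m where m: "gdist u v = Suc m" using assms(1) gr0_implies_Suc by blast
  then have "(u, v) \<in> E ^^ Suc m" using gdist_walk[OF assms(2)] by simp
  then obtain w where "(u, w) \<in> E ^^ m" "(w, v) \<in> E" by auto
  then show ?thesis using gdist_le[of u w m] m E_sym by fastforce
qed

lemma geodesic:
  assumes "gdist z u \<le> Suc d"
  obtains f where "f 0 = z" "f (gdist z u) = u" "\<And>i. i < gdist z u \<Longrightarrow> (f i, f (Suc i)) \<in> E"
    "\<And>i. i \<le> gdist z u \<Longrightarrow> gdist z (f i) = i"
proof -
  obtain f where f: "f 0 = z" "f (gdist z u) = u" "\<And>i. i < gdist z u \<Longrightarrow> (f i, f (Suc i)) \<in> E"
    using gdist_walk[OF assms] unfolding relpow_fun_conv by blast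
  have lower: "gdist z u \<le> gdist z (f i) + (gdist z u - i)" if "i \<le> gdist z u" for i
    using that
  proof (induction rule: inc_induct)
    case (step i)
    then show ?case using gdist_step[OF f(3), of i z] by simp
  qed (use f in simp)
  have upper: "gdist z (f i) \<le> i" if "i \<le> gdist z u" for i
    using that
  proof (induction i)
    case (Suc i)
    then show ?case using gdist_step[OF f(3), of i z] by simp
  qed (use f gdist_eq_0 in simp)
  have "gdist z (f i) = i" if "i \<le> gdist z u" for i
    using lower[OF that] upper[OF that] that by linarith
  then show ?thesis using that f by blast
qed

text \<open>Going out to \<open>v\<close> through \<open>w\<close> and back through
  \<open>w'\<close> would be a closed walk of length \<open>2 * gdist z v < 2 * d\<close>. Its
  levels rise and then fall, and around the top \<open>w \<noteq> w'\<close>, so it never turns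
  back.\<close>

lemma gdist_unique_pred:
  assumes "gdist z v < d" "(v, w) \<in> E" "(v, w') \<in> E" "gdist z w < gdist z v" "gdist z w' < gdist z v"
  shows "w = w'"
proof (rule ccontr)
  assume neq: "w \<noteq> w'"
  define n where "n = gdist z w"
  have v: "gdist z v = Suc n" "gdist z w' = n"
    using gdist_step[OF E_sym[OF assms(2)], of z] gdist_step[OF E_sym[OF assms(3)], of z] assms
    by (auto simp: n_def)
  obtain f where f: "f 0 = z" "f n = w" "\<And>i. i < n \<Longrightarrow> (f i, f (Suc i)) \<in> E"
    "\<And>i. i \<le> n \<Longrightarrow> gdist z (f i) = i"
    using geodesic[of z w] assms by (auto simp: n_def)
  obtain f' where f': "f' 0 = z" "f' n = w'" "\<And>i. i < n \<Longrightarrow> (f' i, f' (Suc i)) \<in> E"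
    "\<And>i. i \<le> n \<Longrightarrow> gdist z (f' i) = i"
    using geodesic[of z w'] assms v by auto
  define h where "h i = (if i \<le> n then f i else if i = Suc n then v else f' (2 * n + 2 - i))" for i
  have level: "gdist z (h i) = (if i \<le> Suc n then i else 2 * n + 2 - i)" if "i \<le> 2 * n + 2" for i
    using f f' v that by (auto simp: h_def)
  have "2 * d \<le> 2 * n + 2"
  proof (rule closed_walk[of "2 * n + 2" h])
    show "h 0 = h (2 * n + 2)" using f f' by (simp add: h_def)
    fix i
    show "(h i, h (Suc i)) \<in> E" if il: "i < 2 * n + 2"
    proof -
      consider "i < n" | "i = n" | "i = Suc n" | "Suc n < i" by linarith
      then show ?thesis
      proof cases
        case 4
        then obtain j where j: "2 * n + 2 - i = Suc j" using il by (cases "2 * n + 2 - i") auto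
        then have "2 * n + 2 - Suc i = j" "j < n" using 4 by auto
        then show ?thesis using 4 j E_sym[OF f'(3)[of j]] by (simp add: h_def)
      qed (use f f' E_sym[OF assms(2)] assms(3) in \<open>simp_all add: h_def\<close>)
    qed
    show "h i \<noteq> h (Suc (Suc i))" if "Suc (Suc i) \<le> 2 * n + 2"
    proof (cases "i = n")
      case True
      then show ?thesis using neq f(2) f'(2) by (simp add: h_def)
    next
      case False
      then have "gdist z (h i) \<noteq> gdist z (h (Suc (Suc i)))"
        using level[of i] level[of "Suc (Suc i)"] that by auto
      then show ?thesis by metis
    qed
  qed simp
  then show False using v assms(1) by simp
qed

text \<open>Two geodesics joined by the edge \<open>vw\<close> form a closed walk of length
  \<open>2 * gdist z v + 1\<close>; vertices two steps apart on it always lie in different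
  levels.\<close>

lemma gdist_level_edge:
  assumes "(v, w) \<in> E" "gdist z w = gdist z v"
  shows "d \<le> gdist z v"
proof (rule ccontr)
  assume less: "\<not> ?thesis"
  define n where "n = gdist z v"
  obtain f where f: "f 0 = z" "f n = v" "\<And>i. i < n \<Longrightarrow> (f i, f (Suc i)) \<in> E"
    "\<And>i. i \<le> n \<Longrightarrow> gdist z (f i) = i"
    using geodesic[of z v] less by (auto simp: n_def)
  obtain f' where f': "f' 0 = z" "f' n = w" "\<And>i. i < n \<Longrightarrow> (f' i, f' (Suc i)) \<in> E"
    "\<And>i. i \<le> n \<Longrightarrow> gdist z (f' i) = i"
    using geodesic[of z w] less assms by (auto simp: n_def)
  define h where "h i = (if i \<le> n then f i else f' (2 * n + 1 - i))" for i
  have level: "gdist z (h i) = (if i \<le> n then i else 2 * n + 1 - i)" if "i \<le> 2 * n + 1" for i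
    using f f' that by (auto simp: h_def)
  have "2 * d \<le> 2 * n + 1"
  proof (rule closed_walk[of "2 * n + 1" h])
    show "h 0 = h (2 * n + 1)" using f f' by (simp add: h_def)
    fix i
    show "(h i, h (Suc i)) \<in> E" if il: "i < 2 * n + 1"
    proof -
      consider "i < n" | "i = n" | "n < i" by linarith
      then show ?thesis
      proof cases
        case 3
        then obtain j where j: "2 * n + 1 - i = Suc j" using il by (cases "2 * n + 1 - i") auto
        then have "2 * n + 1 - Suc i = j" "j < n" using 3 by auto
        then show ?thesis using 3 j E_sym[OF f'(3)[of j]] by (simp add: h_def)
      qed (use f f' assms in \<open>simp_all add: h_def\<close>)
    qed
    show "h i \<noteq> h (Suc (Suc i))" if "Suc (Suc i) \<le> 2 * n + 1"
    proof -
      have "gdist z (h i) \<noteq> gdist z (h (Suc (Suc i)))"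
        using level[of i] level[of "Suc (Suc i)"] that by presburger
      then show ?thesis by metis
    qed
  qed simp
  then show False using less by (simp add: n_def)
qed

end

section \<open>Cycles, distances and components in digraphs\<close>

lemma walk_of_function:
  assumes "i \<le> j"
  shows "pcas (f i) (map (\<lambda>t. (f t, f (Suc t))) [i..<j]) (f j)"
    and "pawalk_verts (f i) (map (\<lambda>t. (f t, f (Suc t))) [i..<j]) = map f [i..<Suc j]"
  using assms by (induction rule: inc_induct) (auto simp: upt_conv_Cons)

text \<open>A shortest stretch between two equal vertices of the walk is a cycle; without loops and
  backtracking its length is at least 3.\<close>

lemma girth_le_closed_walk:
  assumes G: "pair_graph G" and n: "0 < n" "f 0 = f n"
    and arc: "\<And>i. i < n \<Longrightarrow> (f i, f (Suc i)) \<in> parcs G"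
    and nb: "\<And>i. Suc (Suc i) \<le> n \<Longrightarrow> f i \<noteq> f (Suc (Suc i))"
  shows "girth G \<le> enat n"
proof -
  interpret pair_graph G by fact
  define R where "R m \<longleftrightarrow> 0 < m \<and> (\<exists>i. i + m \<le> n \<and> f i = f (i + m))" for m
  have "R n" using n by (auto simp: R_def)
  define m where "m = (LEAST m. R m)"
  have m: "R m" "m \<le> n" unfolding m_def using \<open>R n\<close> by (rule LeastI, rule Least_le)
  have min: "\<not> R l" if "l < m" for l using that unfolding m_def by (rule not_less_Least)
  obtain i where i: "i + m \<le> n" "f i = f (i + m)" using m by (auto simp: R_def)
  have "m \<noteq> 1" using arc[of i] no_loops'[of "f i" "f (Suc i)"] i by auto
  moreover have "m \<noteq> 2" using nb[of i] i by auto
  moreover have "m \<noteq> 0" using m by (auto simp: R_def)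
  ultimately have m3: "3 \<le> m" by linarith
  define p where "p = map (\<lambda>t. (f t, f (Suc t))) [i..<i + m]"
  have "inj_on f (set [Suc i..<Suc (i + m)])"
  proof (rule linorder_inj_onI)
    fix a b assume ab: "a < b" "a \<in> set [Suc i..<Suc (i + m)]" "b \<in> set [Suc i..<Suc (i + m)]"
    show "f a \<noteq> f b"
    proof
      assume "f a = f b"
      then have "R (b - a)" using ab i unfolding R_def by (intro conjI exI[of _ a]) auto
      moreover have "b - a < m" using ab unfolding set_upt atLeastLessThan_iff by linarith
      ultimately show False using min by blast
    qed
  qed auto
  then have "distinct (tl (pawalk_verts (f i) p))"
    using walk_of_function(2)[of i "i + m" f] by (simp add: p_def upt_conv_Cons distinct_map del: upt_Suc)
  moreover have "set p \<subseteq> parcs G" using arc i by (auto simp: p_def)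
  moreover have "pcas (f i) p (f i)" using walk_of_function(1)[of i "i + m" f] i by (simp add: p_def)
  moreover have "f i \<in> pverts G" using arc[of i] in_arcsD1 i m3 by simp
  moreover have "p \<noteq> []" using m3 by (simp add: p_def)
  ultimately have "pre_digraph.cycle (with_proj G) p"
    by (auto simp: pre_digraph.cycle_def pre_digraph.awalk_def cas_with_proj_eq awalk_verts_with_proj_eq)
  then have "girth G \<le> enat (length p)"
    unfolding girth_def using m3 by (intro INF_lower) (simp add: p_def)
  also have "\<dots> \<le> enat n" using m by (simp add: p_def)
  finally show ?thesis .
qed

lemma awalk_relpow:
  assumes "pair_wf_digraph G" "u \<in> pverts G"
  shows "(\<exists>p. pre_digraph.awalk (with_proj G) u p v \<and> length p = n) \<longleftrightarrow> (u, v) \<in> parcs G ^^ n"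
proof -
  interpret pair_wf_digraph G by fact
  show ?thesis using assms(2)
  proof (induction n arbitrary: u)
    case 0
    then show ?case by (auto simp: awalk_Nil_iff)
  next
    case (Suc n)
    have "(\<exists>p. awalk u p v \<and> length p = Suc n) \<longleftrightarrow>
        (\<exists>w. (u, w) \<in> parcs G \<and> (\<exists>p. awalk w p v \<and> length p = n))"
    proof (intro iffI; elim exE conjE)
      fix p assume p: "awalk u p v" "length p = Suc n"
      then obtain e p' where "p = e # p'" by (cases p) auto
      then have "(u, snd e) \<in> parcs G" "awalk (snd e) p' v" "length p' = n"
        using p by (auto simp: awalk_Cons_iff)
      then show "\<exists>w. (u, w) \<in> parcs G \<and> (\<exists>p. awalk w p v \<and> length p = n)" by blast
    next
      fix w p assume "(u, w) \<in> parcs G" "awalk w p v" "length p = n"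
      then show "\<exists>p. awalk u p v \<and> length p = Suc n"
        by (intro exI[of _ "(u, w) # p"]) (simp add: awalk_Cons_iff)
    qed
    also have "\<dots> \<longleftrightarrow> (\<exists>w. (u, w) \<in> parcs G \<and> (w, v) \<in> parcs G ^^ n)"
      using Suc.IH in_arcsD2 by blast
    also have "\<dots> \<longleftrightarrow> (u, v) \<in> parcs G ^^ Suc n" using relpow_Suc_D2 relpow_Suc_I2 by metis
    finally show ?case .
  qed
qed

lemma graph_dist_eq:
  assumes "pair_wf_digraph G" "u \<in> pverts G"
  shows "graph_dist G u v =
    (if \<exists>n. (u, v) \<in> parcs G ^^ n then ereal (real (LEAST n. (u, v) \<in> parcs G ^^ n)) else \<infinity>)"
proof -
  interpret pair_wf_digraph G by fact
  have cost: "awalk_cost (\<lambda>_. 1) p = real (length p)" for p :: "('a \<times> 'a) list"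
    by (simp add: awalk_cost_def sum_list_triv)
  have mu: "graph_dist G u v = (INF p\<in>{p. awalk u p v}. ereal (real (length p)))"
    by (simp add: graph_dist_def \<mu>_def cost)
  note relpow = awalk_relpow[OF assms, of v]
  show ?thesis
  proof (cases "\<exists>n. (u, v) \<in> parcs G ^^ n")
    case True
    define n where "n = (LEAST n. (u, v) \<in> parcs G ^^ n)"
    have "(u, v) \<in> parcs G ^^ n" unfolding n_def using True by (rule LeastI_ex)
    then obtain p where p: "awalk u p v" "length p = n" using relpow by blast
    have "(INF p\<in>{p. awalk u p v}. ereal (real (length p))) = ereal (real n)"
    proof (rule antisym)
      show "(INF p\<in>{p. awalk u p v}. ereal (real (length p))) \<le> ereal (real n)"
        using p by (intro INF_lower2[of p]) auto
      show "ereal (real n) \<le> (INF p\<in>{p. awalk u p v}. ereal (real (length p)))"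
        using relpow by (intro INF_greatest) (auto simp: n_def intro: Least_le)
    qed
    then show ?thesis using True mu by (simp add: n_def)
  next
    case False
    then have "{p. awalk u p v} = {}" using relpow by blast
    then show ?thesis using False mu by (simp add: top_ereal_def)
  qed
qed

text \<open>By symmetry the ends of an arc reach each other, so strong components are closed under
  arcs. The clauses are shaped for \<open>antipodal_components\<close>.\<close>

lemma components_sym_digraph:
  fixes H :: "'a pair_pre_digraph"
  assumes wf: "pair_wf_digraph H" and sym: "sym (parcs H)"
  defines "P \<equiv> verts ` components H"
  shows "\<Union>P = pverts H"
    and "S \<in> P \<Longrightarrow> S' \<in> P \<Longrightarrow> v \<in> S \<Longrightarrow> v \<in> S' \<Longrightarrow> S = S'"
    and "S \<in> P \<Longrightarrow> S \<noteq> {}"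
    and "S \<in> P \<Longrightarrow> u \<in> S \<Longrightarrow> (u, v) \<in> parcs H \<Longrightarrow> v \<in> S"
    and "S \<in> P \<Longrightarrow> T \<subseteq> S \<Longrightarrow> T \<noteq> {} \<Longrightarrow>
      (\<And>u v. u \<in> T \<Longrightarrow> (u, v) \<in> parcs H \<Longrightarrow> v \<in> T) \<Longrightarrow> T = S"
    and "num_cycles H = card P"
    and "num_even_cycles H = card {S \<in> P. even (card S)}"
proof -
  interpret H: pair_wf_digraph H by fact
  have P: "P = H.sccs_verts" using H.sccs_verts_conv by (simp add: P_def components_def)
  have conv: "S \<in> P \<longleftrightarrow> S \<noteq> {} \<and> (\<forall>u\<in>S. \<forall>v\<in>S. u \<rightarrow>\<^sup>*\<^bsub>with_proj H\<^esub> v)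
      \<and> (\<forall>u\<in>S. \<forall>v. v \<notin> S \<longrightarrow> \<not> u \<rightarrow>\<^sup>*\<^bsub>with_proj H\<^esub> v \<or> \<not> v \<rightarrow>\<^sup>*\<^bsub>with_proj H\<^esub> u)" for S
    unfolding P by (rule H.in_sccs_verts_conv_reachable)
  have arc: "u \<rightarrow>\<^sup>*\<^bsub>with_proj H\<^esub> v" if "(u, v) \<in> parcs H" for u v
    using H.reachable_adjI that by auto
  show "\<Union>P = pverts H"
    unfolding P using H.sccs_verts_subsets H.scc_of_in_sccs_verts H.in_scc_of_self by blast
  show "S \<in> P \<Longrightarrow> S' \<in> P \<Longrightarrow> v \<in> S \<Longrightarrow> v \<in> S' \<Longrightarrow> S = S'"
    unfolding P using H.sccs_verts_disjoint by blast
  show "S \<in> P \<Longrightarrow> S \<noteq> {}" using conv by blast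
  show "v \<in> S" if "S \<in> P" "u \<in> S" "(u, v) \<in> parcs H"
    using that conv[of S] arc[OF that(3)] arc[OF symD[OF sym that(3)]] by blast
  show "T = S" if S: "S \<in> P" "T \<subseteq> S" "T \<noteq> {}"
    and T: "\<And>u v. u \<in> T \<Longrightarrow> (u, v) \<in> parcs H \<Longrightarrow> v \<in> T"
  proof -
    obtain t where t: "t \<in> T" using S by blast
    have "s \<in> T" if "s \<in> S" for s
    proof -
      have "t \<rightarrow>\<^sup>*\<^bsub>with_proj H\<^esub> s" using conv[of S] S(1,2) t that by blast
      then have "(t, s) \<in> (parcs H)\<^sup>*" using reachable_rtranclI by force
      then show ?thesis by (induction rule: rtrancl_induct) (use t T in auto)
    qed
    then show ?thesis using S by blast
  qed
  show "num_cycles H = card P"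
    using H.card_sccs_verts by (simp add: P num_cycles_def components_def)
  have "{S \<in> P. even (card S)} = verts ` {C \<in> components H. even (card (verts C))}"
    by (auto simp: P_def)
  moreover have "inj_on verts {C \<in> components H. even (card (verts C))}"
    using H.inj_on_verts_sccs by (rule inj_on_subset) (auto simp: components_def)
  ultimately show "num_even_cycles H = card {S \<in> P. even (card S)}"
    by (simp add: num_even_cycles_def card_image)
qed

theorem theorem2p7:
  fixes G :: "'a pair_pre_digraph" and k g d c c2 :: nat
  assumes "k \<ge> 7" and "odd k"
    and "g = 2 * d" and "g \<ge> 8"
    and "kg_graph k g G" and "excess k g G = 4"
    and "c = num_cycles (excess_graph d G)"
    and "c2 = num_even_cycles (excess_graph d G)"
  shows "(odd d \<longrightarrow> (int d - 1) dvd (int c - 2) \<and> (int d - 1) dvd int c2) \<and>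
         (even d \<longrightarrow> (int d - 1) dvd (int c - 1) \<and> (int d - 1) dvd (int c2 - 1))"
proof -
  have G: "pair_graph G" and reg: "regular k G" and girth: "girth G = enat g"
    using assms(5) by (auto simp: kg_graph_def)
  interpret G: pair_graph G by fact
  have wf: "pair_wf_digraph G" by unfold_locales
  have sym: "(v, u) \<in> parcs G" if "(u, v) \<in> parcs G" for u v
    using G.sym_arcs that by (auto simp: symmetric_def elim: symE)
  interpret T: locally_tree_like "parcs G" d
  proof
    show "(u, v) \<in> parcs G \<Longrightarrow> (v, u) \<in> parcs G" for u v by (rule sym)
    fix f :: "nat \<Rightarrow> 'a" and n
    assume "0 < n" "f 0 = f n" "\<And>i. i < n \<Longrightarrow> (f i, f (Suc i)) \<in> parcs G"
      "\<And>i. Suc (Suc i) \<le> n \<Longrightarrow> f i \<noteq> f (Suc (Suc i))"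
    then have "girth G \<le> enat n" by (rule girth_le_closed_walk[OF G])
    then show "2 * d \<le> n" using girth assms(3) by simp
  qed
  let ?N = "\<lambda>v. {u. (v, u) \<in> parcs G}"
  interpret M: moore_distance "pverts G" ?N T.gdist k d
  proof
    show "finite (pverts G)" by (rule G.pair_finite_verts)
    show "card (?N v) = k" if "v \<in> pverts G" for v
    proof -
      have "out_arcs (with_proj G) v = Pair v ` ?N v" by (auto simp: out_arcs_def)
      then have "card (?N v) = out_degree (with_proj G) v"
        by (simp add: out_degree_def card_image inj_on_def)
      then show ?thesis using reg that by (simp add: regular_def)
    qed
    show "card (pverts G) = 2 * (\<Sum>i<d. (k - 1) ^ i) + 4"
    proof -
      have "int (card (pverts G)) = int (2 * (\<Sum>i<d. (k - 1) ^ i) + 4)"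
        using assms(3,6) by (simp add: excess_def moore_bound_even_def)
      then show ?thesis by (simp only: of_nat_eq_iff)
    qed
    show "7 \<le> k" "3 \<le> d" using assms by auto
    show "?N v \<subseteq> pverts G" for v using G.in_arcsD2 by blast
    show "u \<in> ?N v" if "v \<in> ?N u" for u v using that sym by simp
    show "T.gdist u v = 0 \<longleftrightarrow> u = v" for u v by (rule T.gdist_eq_0)
    show "T.gdist u v = T.gdist v u" for u v by (rule T.gdist_sym)
    show "T.gdist u w \<le> Suc (T.gdist u v)" if "w \<in> ?N v" for u v w
      using that by (intro T.gdist_step) simp
    show "\<exists>w \<in> ?N v. T.gdist u w < T.gdist u v" if "0 < T.gdist u v" "T.gdist u v \<le> Suc d" for u v
      using T.gdist_pred[OF that] by blast
    show "w = w'" if "T.gdist u v < d" "w \<in> ?N v" "w' \<in> ?N v" "T.gdist u w < T.gdist u v"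
      "T.gdist u w' < T.gdist u v" for u v w w'
      using that T.gdist_unique_pred[of u v w w'] by simp
    show "d \<le> T.gdist u v" if "w \<in> ?N v" "T.gdist u w = T.gdist u v" for u v w
      using that T.gdist_level_edge[of v w u] by simp
  qed
  let ?H = "excess_graph d G"
  \<comment> \<open>For unreachable pairs both sides are false: the distance is infinite, and the
    default value of \<open>gdist\<close> is \<open>d + 2\<close>.\<close>
  have dist: "graph_dist G u v = ereal (real (d + 1)) \<longleftrightarrow> T.gdist u v = Suc d" if "u \<in> pverts G" for u v
  proof (cases "\<exists>n. (u, v) \<in> parcs G ^^ n")
    case True
    then show ?thesis
      unfolding graph_dist_eq[OF wf that] T.gdist_def if_P[OF True] ereal.inject of_nat_eq_iff by simp
  next
    case False
    then show ?thesis unfolding graph_dist_eq[OF wf that] T.gdist_def if_not_P[OF False] by simp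
  qed
  have H: "pverts ?H = pverts G"
    "parcs ?H = {(u, v). u \<in> pverts G \<and> v \<in> pverts G \<and> T.gdist u v = Suc d}"
    by (auto simp only: excess_graph_def dist pair_pre_digraph.simps)
  have wfH: "pair_wf_digraph ?H" by unfold_locales (auto simp: H)
  have symH: "Relation.sym (parcs ?H)"
    using T.gdist_sym by (auto simp: H intro!: symI)
  define P where "P = verts ` components ?H"
  note P = components_sym_digraph[OF wfH symH, folded P_def]
  have sub: "S \<subseteq> pverts G" if "S \<in> P" for S using P(1) H(1) that by blast
  interpret C: antipodal_components "pverts G" ?N T.gdist k d P
  proof
    show "\<Union>P = pverts G" using P(1) H(1) by simp
    show "v \<in> S" if "S \<in> P" "u \<in> S" "v \<in> pverts G" "T.gdist u v = Suc d" for S u v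
      using P(4)[OF that(1,2)] that sub by (auto simp: H)
    show "T = S" if "S \<in> P" "T \<subseteq> S" "T \<noteq> {}"
      "\<And>u v. u \<in> T \<Longrightarrow> v \<in> pverts G \<Longrightarrow> T.gdist u v = Suc d \<Longrightarrow> v \<in> T" for S T
      using P(5)[OF that(1-3)] that(4) by (auto simp: H)
  qed (use P in blast)+
  have "4 \<le> d" using assms(3,4) by simp
  then show ?thesis
    using C.component_count_dvd[OF assms(2)] P(6,7) assms(7,8) by simp
qed

end
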